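(* Let $1\le p<\infty$ and let $\Omega$ be a bounded domain in $\mathbb{R}^2$ of class $\mathfrak{N}^{2,1}$. Then the functional $$u\mapsto\big(\|u\|_{1,p,\partial\Omega}^p+\|\partial_\tau^2u\|_{p,\partial\Omega}^p\big)^{1/p},$$ where $\tau$ is the unit tangential vector on $\partial\Omega$, is a norm on $W^{2,p}(\partial\Omega)$ which is equivalent to the standard norm $\|\cdot\|_{2,p,\partial\Omega}$.
   Context: A bounded domain (bounded, open, connected set) $\Omega\subset\mathbb{R}^2$ is of class $\mathfrak{N}^{2,1}$ if there exist $a,b>0$, finitely many local (Cartesian, i.e. obtained by rigid motion) coordinate systems $(x_r^1,x_r^2)$, $r=1,\dots,m$, and functions $a_r:\overline{\Delta_r}\to\mathbb{R}$, $\Delta_r=(-a,a)$, of class $C^{2,1}(\overline{\Delta_r})$ (i.e. $a_r$ and its derivatives of order $\le 2$ are Lipschitz continuous on $\overline{\Delta_r}$), such that each point of $\partial\Omega$ has an open neighborhood $V$ for which, for some $r$, $V\cap\partial\Omega=\{(t,a_r(t)):t\in\Delta_r\}$, $V\cap\Omega=\{(t,s):t\in\Delta_r,\ a_r(t)<s<a_r(t)+b\}$ and $V\cap(\mathbb{R}^2\setminus\overline\Omega)=\{(t,s):t\in\Delta_r,\ a_r(t)-b<s<a_r(t)\}$. Such a system is fixed. For a complex function $f$ defined a.e. on $\partial\Omega$ put $f_r(t):=f(t,a_r(t))$ (in the $r$-th coordinates), $t\in\Delta_r$. $L^p(\partial\Omega)$ is the space of $f$ with $f_r\in L^p(\Delta_r)$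 for all $r$, with norm $\|f\|_{p,\partial\Omega}=\big(\sum_{r=1}^m\|f_r\|_{L^p(\Delta_r)}^p\big)^{1/p}$. For $k\in\{1,2\}$, $W^{k,p}(\partial\Omega)$ is the space of $f\in L^p(\partial\Omega)$ with $f_r\in W^{k,p}(\Delta_r)$ for all $r$, with norm $\|f\|_{k,p,\partial\Omega}=\big(\sum_{r=1}^m\|f_r\|_{k,p,\Delta_r}^p\big)^{1/p}$, where $\|g\|_{k,p,\Delta_r}=\big(\sum_{j=0}^k\int_{\Delta_r}|g^{(j)}(t)|^p\,dt\big)^{1/p}$. Tangential derivative: the unit tangent vector in the $r$-th chart is $\tau=\theta_r^{-1}(1,a_r')$ with $\theta_r(t)=\sqrt{1+a_r'(t)^2}$, and the tangential derivative $\partial_\tau$ is given in this chart by $(\partial_\tau u)_r=\theta_r^{-1}\frac{d}{dt}u_r$; $\partial_\tau^2u=\partial_\tau(\partial_\tau u)$ (a change of the orientation of $\tau$ does not affect $\partial_\tau^2u$). *)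

theory Defs
  imports "HOL-Analysis.Analysis"
begin

section \<open>Sobolev spaces on an open subset of the real line\<close>

definition test_function :: "real set \<Rightarrow> (real \<Rightarrow> real) \<Rightarrow> bool" where
  "test_function I \<phi> \<longleftrightarrow>
     (\<forall>n x. ((deriv ^^ n) \<phi>) field_differentiable (at x)) \<and>
     (\<exists>K. compact K \<and> K \<subseteq> I \<and> (\<forall>x. x \<notin> K \<longrightarrow> \<phi> x = 0))"

definition locally_integrable :: "real set \<Rightarrow> (real \<Rightarrow> complex) \<Rightarrow> bool" where
  "locally_integrable I g \<longleftrightarrow> (\<forall>K. compact K \<and> K \<subseteq> I \<longrightarrow> integrable (lebesgue_on K) g)"

definition has_weak_deriv :: "real set \<Rightarrow> nat \<Rightarrow> (real \<Rightarrow> complex) \<Rightarrow> (real \<Rightarrow> complex) \<Rightarrow> bool" where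
  "has_weak_deriv I j g h \<longleftrightarrow>
     locally_integrable I g \<and> locally_integrable I h \<and>
     (\<forall>\<phi>. test_function I \<phi> \<longrightarrow>
        integral\<^sup>L (lebesgue_on I) (\<lambda>t. (deriv ^^ j) \<phi> t *\<^sub>R g t) =
        (- 1) ^ j * integral\<^sup>L (lebesgue_on I) (\<lambda>t. \<phi> t *\<^sub>R h t))"

text \<open>A representative of the \<open>j\<close>-th weak derivative, which is unique up to null sets;
  it is unspecified if there is no weak derivative.\<close>

definition weak_deriv :: "real set \<Rightarrow> nat \<Rightarrow> (real \<Rightarrow> complex) \<Rightarrow> real \<Rightarrow> complex" where
  "weak_deriv I j g = (if j = 0 then g else (SOME h. has_weak_deriv I j g h))"

definition Lp_space :: "real set \<Rightarrow> real \<Rightarrow> (real \<Rightarrow> complex) set" where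
  "Lp_space I p = {g. g \<in> borel_measurable (lebesgue_on I) \<and>
                      integrable (lebesgue_on I) (\<lambda>t. cmod (g t) powr p)}"

definition Lp_norm :: "real set \<Rightarrow> real \<Rightarrow> (real \<Rightarrow> complex) \<Rightarrow> real" where
  "Lp_norm I p g = (integral\<^sup>L (lebesgue_on I) (\<lambda>t. cmod (g t) powr p)) powr (1 / p)"

definition Sobolev_space :: "real set \<Rightarrow> nat \<Rightarrow> real \<Rightarrow> (real \<Rightarrow> complex) set" where
  "Sobolev_space I k p = {g. g \<in> Lp_space I p \<and>
     (\<forall>j\<in>{1..k}. \<exists>h. has_weak_deriv I j g h \<and> h \<in> Lp_space I p)}"

definition Sobolev_norm :: "real set \<Rightarrow> nat \<Rightarrow> real \<Rightarrow> (real \<Rightarrow> complex) \<Rightarrow> real" where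
  "Sobolev_norm I k p g =
     (\<Sum>j=0..k. integral\<^sup>L (lebesgue_on I) (\<lambda>t. cmod (weak_deriv I j g t) powr p)) powr (1 / p)"


section \<open>Domains with boundary of class C(2,1)\<close>

definition C21_on :: "real \<Rightarrow> real \<Rightarrow> (real \<Rightarrow> real) \<Rightarrow> bool" where
  "C21_on c d \<alpha> \<longleftrightarrow> (\<exists>\<alpha>1 \<alpha>2.
     (\<forall>t\<in>{c..d}. (\<alpha> has_real_derivative \<alpha>1 t) (at t within {c..d})) \<and>
     (\<forall>t\<in>{c..d}. (\<alpha>1 has_real_derivative \<alpha>2 t) (at t within {c..d})) \<and>
     (\<exists>L. L-lipschitz_on {c..d} \<alpha>) \<and>
     (\<exists>L. L-lipschitz_on {c..d} \<alpha>1) \<and>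
     (\<exists>L. L-lipschitz_on {c..d} \<alpha>2))"

definition rigid_motion :: "(real \<times> real \<Rightarrow> real \<times> real) \<Rightarrow> bool" where
  "rigid_motion \<Phi> \<longleftrightarrow> (\<exists>c L. orthogonal_transformation L \<and> \<Phi> = (\<lambda>z. c + L z))"

text \<open>A system of \<open>ch_num\<close> local coordinate systems, indexed by \<open>1, \<dots>, ch_num\<close>. The map
  \<open>ch_motion S r\<close> sends the coordinates \<open>(t, s)\<close> of a point in the \<open>r\<close>-th coordinate system to
  the point itself, \<open>ch_fun S r\<close> is the function whose graph describes the boundary, and
  \<open>ch_a\<close>, \<open>ch_b\<close> are the sizes of the coordinate strips.\<close>

record chart_system =
  ch_a :: real
  ch_b :: real
  ch_num :: nat
  ch_motion :: "nat \<Rightarrow> real \<times> real \<Rightarrow> real \<times> real"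
  ch_fun :: "nat \<Rightarrow> real \<Rightarrow> real"

definition ch_int :: "chart_system \<Rightarrow> real set" where
  "ch_int S = {- ch_a S <..< ch_a S}"

definition N21_system :: "chart_system \<Rightarrow> (real \<times> real) set \<Rightarrow> bool" where
  "N21_system S \<Omega> \<longleftrightarrow>
     ch_a S > 0 \<and> ch_b S > 0 \<and>
     (\<forall>r\<in>{1..ch_num S}. rigid_motion (ch_motion S r) \<and> C21_on (- ch_a S) (ch_a S) (ch_fun S r)) \<and>
     (\<forall>x\<in>frontier \<Omega>. \<exists>V. open V \<and> x \<in> V \<and> (\<exists>r\<in>{1..ch_num S}.
        V \<inter> frontier \<Omega> =
          ch_motion S r ` {(t, s). t \<in> ch_int S \<and> s = ch_fun S r t} \<and>
        V \<inter> \<Omega> =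
          ch_motion S r ` {(t, s). t \<in> ch_int S \<and> ch_fun S r t < s \<and> s < ch_fun S r t + ch_b S} \<and>
        V \<inter> (- closure \<Omega>) =
          ch_motion S r ` {(t, s). t \<in> ch_int S \<and> ch_fun S r t - ch_b S < s \<and> s < ch_fun S r t}))"

definition bounded_domain :: "(real \<times> real) set \<Rightarrow> bool" where
  "bounded_domain \<Omega> \<longleftrightarrow> bounded \<Omega> \<and> open \<Omega> \<and> connected \<Omega>"


section \<open>Function spaces on the boundary\<close>

text \<open>A function on the boundary is represented by a function on the plane, of which only the values
  on the graphs \<open>(t, ch_fun S r t)\<close> matter. \<open>local_rep S f r\<close> is its expression \<open>f\<^sub>r\<close> in the
  \<open>r\<close>-th coordinate system. Norms and spaces on the boundary see a function only through the family
  of its local expressions, so the Lebesgue space and norm are defined on such families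
  \<open>F = (\<lambda>r. f\<^sub>r)\<close>.\<close>

definition local_rep :: "chart_system \<Rightarrow> (real \<times> real \<Rightarrow> complex) \<Rightarrow> nat \<Rightarrow> real \<Rightarrow> complex" where
  "local_rep S f r t = f (ch_motion S r (t, ch_fun S r t))"

definition bd_Lp :: "chart_system \<Rightarrow> real \<Rightarrow> (nat \<Rightarrow> real \<Rightarrow> complex) set" where
  "bd_Lp S p = {F. \<forall>r\<in>{1..ch_num S}. F r \<in> Lp_space (ch_int S) p}"

definition bd_Lp_norm :: "chart_system \<Rightarrow> real \<Rightarrow> (nat \<Rightarrow> real \<Rightarrow> complex) \<Rightarrow> real" where
  "bd_Lp_norm S p F = (\<Sum>r=1..ch_num S. Lp_norm (ch_int S) p (F r) powr p) powr (1 / p)"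

definition bd_Sobolev :: "chart_system \<Rightarrow> nat \<Rightarrow> real \<Rightarrow> (real \<times> real \<Rightarrow> complex) set" where
  "bd_Sobolev S k p = {f. local_rep S f \<in> bd_Lp S p \<and>
     (\<forall>r\<in>{1..ch_num S}. local_rep S f r \<in> Sobolev_space (ch_int S) k p)}"

definition bd_Sobolev_norm ::
    "chart_system \<Rightarrow> nat \<Rightarrow> real \<Rightarrow> (real \<times> real \<Rightarrow> complex) \<Rightarrow> real" where
  "bd_Sobolev_norm S k p f =
     (\<Sum>r=1..ch_num S. Sobolev_norm (ch_int S) k p (local_rep S f r) powr p) powr (1 / p)"

text \<open>Equality almost everywhere on the boundary.\<close>

definition bd_ae_eq ::
    "chart_system \<Rightarrow> (real \<times> real \<Rightarrow> complex) \<Rightarrow> (real \<times> real \<Rightarrow> complex) \<Rightarrow> bool" where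
  "bd_ae_eq S f g \<longleftrightarrow>
     (\<forall>r\<in>{1..ch_num S}. AE t in lebesgue_on (ch_int S). local_rep S f r t = local_rep S g r t)"


section \<open>Tangential derivatives\<close>

definition ch_theta :: "chart_system \<Rightarrow> nat \<Rightarrow> real \<Rightarrow> real" where
  "ch_theta S r t = sqrt (1 + (deriv (ch_fun S r) t)\<^sup>2)"

text \<open>The tangential derivative acts on the family of local expressions; the orientation of the
  tangent vector in the \<open>r\<close>-th coordinate system is that of increasing \<open>t\<close>. The orientations of
  different coordinate systems need not agree, but the second derivative does not depend on them.\<close>

definition tang_deriv :: "chart_system \<Rightarrow> (nat \<Rightarrow> real \<Rightarrow> complex) \<Rightarrow> nat \<Rightarrow> real \<Rightarrow> complex" where
  "tang_deriv S F r t = weak_deriv (ch_int S) 1 (F r) t / of_real (ch_theta S r t)"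

definition tang_deriv2 :: "chart_system \<Rightarrow> (real \<times> real \<Rightarrow> complex) \<Rightarrow> nat \<Rightarrow> real \<Rightarrow> complex" where
  "tang_deriv2 S u = tang_deriv S (tang_deriv S (local_rep S u))"

text \<open>Existence of the weak derivatives in the definition of \<open>tang_deriv2 S u\<close>.\<close>

definition tang_deriv2_exists :: "chart_system \<Rightarrow> (real \<times> real \<Rightarrow> complex) \<Rightarrow> bool" where
  "tang_deriv2_exists S u \<longleftrightarrow> (\<forall>r\<in>{1..ch_num S}.
     (\<exists>h. has_weak_deriv (ch_int S) 1 (local_rep S u r) h) \<and>
     (\<exists>h. has_weak_deriv (ch_int S) 1 (tang_deriv S (local_rep S u) r) h))"

definition tang_norm :: "chart_system \<Rightarrow> real \<Rightarrow> (real \<times> real \<Rightarrow> complex) \<Rightarrow> real" where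
  "tang_norm S p u =
     (bd_Sobolev_norm S 1 p u powr p + bd_Lp_norm S p (tang_deriv2 S u) powr p) powr (1 / p)"


section \<open>Norms on spaces of functions modulo equality almost everywhere\<close>

definition bd_norm_on ::
    "chart_system \<Rightarrow> (real \<times> real \<Rightarrow> complex) set \<Rightarrow> ((real \<times> real \<Rightarrow> complex) \<Rightarrow> real) \<Rightarrow> bool" where
  "bd_norm_on S V N \<longleftrightarrow>
     (\<lambda>x. 0) \<in> V \<and>
     (\<forall>u\<in>V. \<forall>v\<in>V. (\<lambda>x. u x + v x) \<in> V) \<and>
     (\<forall>c. \<forall>u\<in>V. (\<lambda>x. c * u x) \<in> V) \<and>
     (\<forall>u\<in>V. \<forall>v. bd_ae_eq S u v \<longrightarrow> v \<in> V \<and> N v = N u) \<and>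
     (\<forall>u\<in>V. N u \<ge> 0) \<and>
     (\<forall>u\<in>V. N u = 0 \<longleftrightarrow> bd_ae_eq S u (\<lambda>x. 0)) \<and>
     (\<forall>c. \<forall>u\<in>V. N (\<lambda>x. c * u x) = cmod c * N u) \<and>
     (\<forall>u\<in>V. \<forall>v\<in>V. N (\<lambda>x. u x + v x) \<le> N u + N v)"

definition equivalent_on :: "'v set \<Rightarrow> ('v \<Rightarrow> real) \<Rightarrow> ('v \<Rightarrow> real) \<Rightarrow> bool" where
  "equivalent_on V N M \<longleftrightarrow> (\<exists>c C. 0 < c \<and> 0 < C \<and> (\<forall>u\<in>V. c * M u \<le> N u \<and> N u \<le> C * M u))"

end

theory Submission
  imports Defs
begin

text \<open>In a chart write \<open>h\<^sub>1\<close>, \<open>h\<^sub>2\<close> for the first two weak derivatives of the local expression of \<open>u\<close>,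
and \<open>w = 1 / \<theta>\<close>. Since the boundary function is of class C(2,1), the function \<open>w\<close> is continuously
differentiable, \<open>w\<close>, \<open>1 / w\<close> and \<open>w'\<close> are bounded, and the product rule gives
\<open>\<partial>\<^sub>\<tau>\<^sup>2 u = w (w h\<^sub>2 + w' h\<^sub>1)\<close> almost everywhere (\<open>tang_deriv2_eq\<close>). The theorem follows from
this formula. It bounds \<open>\<partial>\<^sub>\<tau>\<^sup>2 u\<close> pointwise by \<open>h\<^sub>1\<close> and \<open>h\<^sub>2\<close>, and, solved for \<open>h\<^sub>2\<close>, it bounds \<open>h\<^sub>2\<close>
by \<open>\<partial>\<^sub>\<tau>\<^sup>2 u\<close> and \<open>h\<^sub>1\<close>; as both norms contain \<open>h\<^sub>1\<close>, they are equivalent (\<open>tang_deriv2_Lp\<close>,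
\<open>equivalent_tang_norm\<close>). It also shows that \<open>\<partial>\<^sub>\<tau>\<^sup>2\<close> is linear up to null sets. Hence the functional is the
\<open>L\<^sup>p\<close> norm of a finite family of functions that depends linearly on \<open>u\<close>, and the norm axioms reduce to the
Minkowski inequality for such families (\<open>Lp_family_norm_triangle\<close>).

Two facts about weak derivatives carry the formula. They are unique almost everywhere, by the fundamental
lemma of the calculus of variations: a locally integrable function that is orthogonal to all test functions
has vanishing integral over every interval, hence over every measurable set. And they satisfy the product
rule with a factor \<open>w\<close> that is only continuously differentiable. For this the defining identity is tested
with \<open>\<phi> w\<close>, which is not smooth; it is extended to such functions by writing them as a positive smooth bump
times a continuously differentiable function and approximating the latter, together with its derivative, by
polynomials (\<open>has_weak_deriv_C1_test_function\<close>).\<close>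

section \<open>Smooth functions of compact support\<close>

text \<open>The case \<open>k = 0\<close> is the standard smooth function that is flat at the origin. The powers of \<open>1 / x\<close> are
included because differentiation produces them.\<close>

definition flat :: "nat \<Rightarrow> real \<Rightarrow> real" where
  "flat k x = (if x > 0 then (1 / x) ^ k * exp (- (1 / x)) else 0)"

lemma flat_tendsto_0: "(flat k \<longlongrightarrow> 0) (at_right 0)"
proof -
  have "((\<lambda>t::real. t ^ k / exp t) \<longlongrightarrow> 0) at_top"
    by (rule tendsto_power_div_exp_0)
  then have "((\<lambda>x::real. (inverse x) ^ k / exp (inverse x)) \<longlongrightarrow> 0) (at_right 0)"
    by (rule filterlim_compose[OF _ filterlim_inverse_at_top_right])
  moreover have "eventually (\<lambda>x::real. x > 0) (at_right 0)"
    by (simp add: eventually_at_right_less)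
  ultimately show ?thesis
    by (elim Lim_transform_eventually, elim eventually_mono)
      (simp add: flat_def exp_minus divide_inverse)
qed

lemma flat_has_real_derivative:
  "(flat k has_real_derivative (flat (k + 2) x - k * flat (k + 1) x)) (at x)"
proof (cases x "0::real" rule: linorder_cases)
  case less
  have "(flat k has_real_derivative 0) (at x)"
    by (rule has_field_derivative_transform_within_open[where S = "{..<0}" and f = "\<lambda>_. 0"])
      (use less in \<open>auto simp: flat_def\<close>)
  then show ?thesis using less by (simp add: flat_def)
next
  case equal
  have "((\<lambda>y. (flat k y - flat k 0) / (y - 0)) \<longlongrightarrow> 0) (at 0)"
  proof (rule filterlim_split_at)
    show "((\<lambda>y. (flat k y - flat k 0) / (y - 0)) \<longlongrightarrow> 0) (at_left 0)"
      by (rule Lim_transform_eventually[OF tendsto_const eventually_at_leftI[of "-1"]])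
        (auto simp: flat_def)
    show "((\<lambda>y. (flat k y - flat k 0) / (y - 0)) \<longlongrightarrow> 0) (at_right 0)"
      by (rule Lim_transform_eventually[OF flat_tendsto_0[of "k + 1"] eventually_at_rightI[of _ 1]])
        (auto simp: flat_def)
  qed
  then show ?thesis using equal by (simp add: has_field_derivative_iff flat_def)
next
  case greater
  have inv: "((\<lambda>x. 1 / x) has_real_derivative - (1 / x)\<^sup>2) (at x)"
    using greater by (auto intro!: derivative_eq_intros simp: power2_eq_square)
  have "((\<lambda>x. (1 / x) ^ k * exp (- (1 / x))) has_real_derivative
          (flat (k + 2) x - k * flat (k + 1) x)) (at x)"
    by (rule DERIV_cong[OF DERIV_mult[OF DERIV_power[OF inv] DERIV_fun_exp[OF DERIV_minus[OF inv]]]])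
      (use greater in \<open>cases k; simp add: flat_def power2_eq_square algebra_simps\<close>)
  then show ?thesis
    by (rule has_field_derivative_transform_within_open[where S = "{0<..}"])
      (use greater in \<open>auto simp: flat_def\<close>)
qed

text \<open>An algebra of functions that is closed under differentiation, so all its members are smooth. It contains
the polynomials and the bump functions, which is all that is needed here, and it spares a theory of smooth
functions with Leibniz and chain rules of higher order.\<close>

inductive elementary :: "(real \<Rightarrow> real) \<Rightarrow> bool" where
  elementary_flat: "elementary (\<lambda>x. flat k (m * x + q))"
| elementary_const: "elementary (\<lambda>x. c)"
| elementary_ident: "elementary (\<lambda>x. x)"
| elementary_add: "elementary f \<Longrightarrow> elementary g \<Longrightarrow> elementary (\<lambda>x. f x + g x)"
| elementary_mult: "elementary f \<Longrightarrow> elementary g \<Longrightarrow> elementary (\<lambda>x. f x * g x)"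

lemma elementary_derivative:
  assumes "elementary f"
  shows "\<exists>f'. elementary f' \<and> (\<forall>x. (f has_real_derivative f' x) (at x))"
  using assms
proof induction
  case (elementary_flat k m q)
  let ?f' = "\<lambda>x. m * (flat (k + 2) (m * x + q) + (- real k) * flat (k + 1) (m * x + q))"
  have "elementary ?f'" by (intro elementary.intros)
  moreover have "((\<lambda>x. flat k (m * x + q)) has_real_derivative ?f' x) (at x)" for x
    by (rule DERIV_chain2[OF flat_has_real_derivative, THEN DERIV_cong])
      (auto intro!: derivative_eq_intros)
  ultimately show ?case by blast
next
  case (elementary_const c)
  show ?case by (intro exI[of _ "\<lambda>x. 0"] conjI elementary.intros allI) auto
next
  case elementary_ident
  show ?case by (intro exI[of _ "\<lambda>x. 1"] conjI elementary.intros allI) auto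
next
  case (elementary_add f g)
  then obtain f' g' where "elementary f'" "\<forall>x. (f has_real_derivative f' x) (at x)"
    "elementary g'" "\<forall>x. (g has_real_derivative g' x) (at x)" by blast
  then show ?case
    by (intro exI[of _ "\<lambda>x. f' x + g' x"] conjI elementary.intros allI DERIV_add) auto
next
  case (elementary_mult f g)
  then obtain f' g' where "elementary f'" "\<forall>x. (f has_real_derivative f' x) (at x)"
    "elementary g'" "\<forall>x. (g has_real_derivative g' x) (at x)" by blast
  with elementary_mult show ?case
    by (intro exI[of _ "\<lambda>x. f' x * g x + g' x * f x"] conjI elementary.intros allI DERIV_mult) auto
qed

lemma elementary_deriv:
  assumes "elementary f"
  shows "elementary (deriv f)" "(f has_real_derivative deriv f x) (at x)"
proof -
  obtain f' where f': "elementary f'" "\<And>x. (f has_real_derivative f' x) (at x)"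
    using elementary_derivative[OF assms] by blast
  then have "deriv f = f'" by (intro ext DERIV_imp_deriv)
  with f' show "elementary (deriv f)" "(f has_real_derivative deriv f x) (at x)" by auto
qed

lemma elementary_smooth:
  assumes "elementary f"
  shows "(deriv ^^ n) f field_differentiable (at x)"
proof -
  have "elementary ((deriv ^^ n) f)"
    by (induction n) (auto intro: assms elementary_deriv)
  then show ?thesis
    using elementary_deriv(2) field_differentiable_def by blast
qed

lemma elementary_polynomial: "real_polynomial_function f \<Longrightarrow> elementary f"
proof (induction rule: real_polynomial_function.induct)
  case (linear f)
  then obtain c where "f = (\<lambda>x. x * c)" by (auto simp: real_bounded_linear)
  then show ?case by (auto intro: elementary.intros)
qed (auto intro: elementary.intros)

text \<open>A smooth function that is positive exactly on the interval from \<open>c\<close> to \<open>d\<close>. The parameter \<open>m\<close> rescales the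
argument; for \<open>m \<longlonglongrightarrow> \<infinity>\<close> the bumps tend to the indicator function, since \<open>exp (- 1 / (m y)) \<longlonglongrightarrow> 1\<close> for
\<open>y > 0\<close>. The arguments are written in the form that \<open>elementary\<close> admits.\<close>

definition bump :: "real \<Rightarrow> real \<Rightarrow> real \<Rightarrow> real \<Rightarrow> real" where
  "bump m c d x = flat 0 (m * x + (- m * c)) * flat 0 ((- m) * x + m * d)"

lemma elementary_bump: "elementary (bump m c d)"
  unfolding bump_def by (intro elementary.intros)

lemma bump_eq:
  assumes "m > 0"
  shows "bump m c d x =
    (if c < x \<and> x < d then exp (- (1 / (m * (x - c)))) * exp (- (1 / (m * (d - x)))) else 0)"
proof -
  have "m * x + (- m * c) = m * (x - c)" "(- m) * x + m * d = m * (d - x)"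
    by (auto simp: algebra_simps)
  with assms show ?thesis unfolding bump_def flat_def by (auto simp: zero_less_mult_iff)
qed

lemma test_function_mult_bump:
  assumes "{c..d} \<subseteq> I" "elementary f" "m > 0"
  shows "test_function I (\<lambda>x. bump m c d x * f x)"
  unfolding test_function_def
  using assms by (intro conjI allI elementary_smooth elementary_mult elementary_bump 
      exI[of _ "{c..d}"]) (auto simp: bump_eq)

lemma bump_bounds: "m > 0 \<Longrightarrow> 0 \<le> bump m c d x" "m > 0 \<Longrightarrow> bump m c d x \<le> 1"
  by (auto simp: bump_eq intro!: mult_le_one)

lemma bump_tendsto_indicator:
  "(\<lambda>n. bump (real (Suc n)) c d x) \<longlonglongrightarrow> indicator {c<..<d} x"
proof (cases "c < x \<and> x < d")
  case True
  have *: "(\<lambda>n. exp (- (1 / (real (Suc n) * y)))) \<longlonglongrightarrow> 1" if "y > 0" for y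
  proof -
    have "(\<lambda>n. exp (- (inverse (real (Suc n)) * inverse y))) \<longlonglongrightarrow> exp (- (0 * inverse y))"
      by (intro tendsto_intros LIMSEQ_inverse_real_of_nat)
    then show ?thesis by (simp add: divide_inverse)
  qed
  have "(\<lambda>n. exp (- (1 / (real (Suc n) * (x - c)))) * exp (- (1 / (real (Suc n) * (d - x))))) 
    \<longlonglongrightarrow> 1 * 1"
    using True by (intro tendsto_mult *) auto
  then show ?thesis using True by (simp add: bump_eq del: of_nat_Suc)
qed (auto simp: bump_eq simp del: of_nat_Suc)

section \<open>The fundamental lemma of the calculus of variations\<close>

text \<open>Open intervals form an intersection-stable generator of the Borel sets, so the Borel sets over which the
integral of \<open>h\<close> vanishes are all of them, by Dynkin's theorem. A Lebesgue measurable set differs from a Borel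
set by a null set, and an integrable function with vanishing integrals over all measurable sets is zero.\<close>

lemma AE_zero_if_open_interval_integrals_zero:
  fixes h :: "real \<Rightarrow> complex"
  assumes h: "integrable (lebesgue_on {l<..<r}) h"
    and zero: "\<And>c d. l \<le> c \<Longrightarrow> c < d \<Longrightarrow> d \<le> r \<Longrightarrow>
      (LINT x|lebesgue_on {l<..<r}. indicator {c<..<d} x *\<^sub>R h x) = 0"
  shows "AE x in lebesgue_on {l<..<r}. h x = 0"
proof -
  define \<mu> where "\<mu> = lebesgue_on {l<..<r}"
  have space: "space \<mu> = {l<..<r}" by (simp add: \<mu>_def)
  have borel_sets: "A \<inter> {l<..<r} \<in> sets \<mu>" if "A \<in> sets borel" for A
    using that unfolding \<mu>_def by (auto simp: sets_restrict_space)
  have ind_int: "integrable \<mu> (\<lambda>x. indicator A x *\<^sub>R h x)" if "A \<inter> {l<..<r} \<in> sets \<mu>" for A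
  proof -
    have "integrable \<mu> (\<lambda>x. indicator (A \<inter> {l<..<r}) x *\<^sub>R h x)"
      by (intro integrable_mult_indicator that h[folded \<mu>_def])
    then show ?thesis
      by (rule Bochner_Integration.integrable_cong[THEN iffD1, rotated -1])
        (auto simp: space indicator_def)
  qed
  have interval: "(LINT x|\<mu>. indicator {a<..<b} x *\<^sub>R h x) = 0" for a b
  proof (cases "max a l < min b r")
    case True
    have "(LINT x|\<mu>. indicator {a<..<b} x *\<^sub>R h x) =
        (LINT x|\<mu>. indicator {max a l<..<min b r} x *\<^sub>R h x)"
      by (rule Bochner_Integration.integral_cong) (auto simp: space indicator_def)
    also have "\<dots> = 0" unfolding \<mu>_def by (rule zero) (use True in auto)
    finally show ?thesis .
  next
    case False
    have "(LINT x|\<mu>. indicator {a<..<b} x *\<^sub>R h x) = (LINT x|\<mu>. 0)"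
      by (rule Bochner_Integration.integral_cong) (use False in \<open>auto simp: space indicator_def\<close>)
    then show ?thesis by simp
  qed
  have total: "(LINT x|\<mu>. h x) = 0"
  proof -
    have "(LINT x|\<mu>. h x) = (LINT x|\<mu>. indicator {l<..<r} x *\<^sub>R h x)"
      by (rule Bochner_Integration.integral_cong) (auto simp: space indicator_def)
    then show ?thesis using interval by simp
  qed
  have borel: "(LINT x|\<mu>. indicator A x *\<^sub>R h x) = 0" if "A \<in> sets borel" for A
  proof -
    let ?G = "range (\<lambda>(a, b). {a<..<b}) :: real set set"
    have borel_eq: "sets borel = sigma_sets UNIV ?G"
      by (subst borel_eq_box) (simp add: box_real case_prod_unfold)
    have "Int_stable ?G"
    proof (rule Int_stableI)
      fix A B assume "A \<in> ?G" "B \<in> ?G"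
      then obtain a b c d where "A = {a<..<b}" "B = {c<..<d}" by auto
      then have "A \<inter> B = (\<lambda>(a, b). {a<..<b}) (max a c, min b d)" by auto
      then show "A \<inter> B \<in> ?G" by blast
    qed
    moreover have "?G \<subseteq> Pow UNIV" by simp
    moreover have "A \<in> sigma_sets UNIV ?G" using that borel_eq by simp
    ultimately show ?thesis
    proof (induction rule: sigma_sets_induct_disjoint)
      case (basic A)
      then show ?case using interval by auto
    next
      case empty
      show ?case by simp
    next
      case (compl A)
      then have "A \<in> sets borel" by (simp add: borel_eq)
      then have "integrable \<mu> (\<lambda>x. indicator A x *\<^sub>R h x)" by (intro ind_int borel_sets)
      then have "(LINT x|\<mu>. h x - indicator A x *\<^sub>R h x) = 0"
        using h[folded \<mu>_def] compl total by simp
      also have "(\<lambda>x. h x - indicator A x *\<^sub>R h x) = (\<lambda>x. indicator (UNIV - A) x *\<^sub>R h x)"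
        by (auto simp: indicator_def)
      finally show ?case .
    next
      case (union A)
      then have A: "A i \<in> sets borel" for i by (auto simp: borel_eq)
      let ?B = "\<lambda>i. A i \<inter> {l<..<r}"
      have "set_integrable \<mu> (\<Union>i. ?B i) h"
        unfolding set_integrable_def
        by (intro integrable_mult_indicator h[folded \<mu>_def] sets.countable_UN)
          (auto intro: borel_sets A)
      then have "(LINT x:(\<Union>i. ?B i)|\<mu>. h x) = (\<Sum>i. (LINT x:(?B i)|\<mu>. h x))"
        using union.hyps(1) by (intro lebesgue_integral_countable_add borel_sets A)
          (auto simp: disjoint_family_on_def)
      also have "\<dots> = (\<Sum>i. LINT x|\<mu>. indicator (A i) x *\<^sub>R h x)"
        unfolding set_lebesgue_integral_def
        by (intro suminf_cong Bochner_Integration.integral_cong) (auto simp: space indicator_def)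
      also have "\<dots> = 0" using union by simp
      also have "(LINT x:(\<Union>i. ?B i)|\<mu>. h x) = (LINT x|\<mu>. indicator (\<Union>i. A i) x *\<^sub>R h x)"
        unfolding set_lebesgue_integral_def
        by (intro Bochner_Integration.integral_cong) (auto simp: space indicator_def)
      finally show ?case .
    qed
  qed
  interpret finite_measure \<mu>
    unfolding \<mu>_def by (rule finite_measure_lebesgue_on) simp
  have "AE x in \<mu>. h x = 0"
  proof (rule density_zero[OF h[folded \<mu>_def]])
    fix A assume "A \<in> sets \<mu>"
    then have "A \<in> sets lebesgue" "A \<subseteq> {l<..<r}"
      by (auto simp: \<mu>_def sets_restrict_space)
    then obtain B N N' where A: "A = B \<union> N" "N \<subseteq> N'" "N' \<in> null_sets lborel" "B \<in> sets lborel"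
      by (auto elim: sets_completionE)
    have "AE x in lebesgue. x \<notin> N'"
      using A(3) by (intro AE_not_in null_sets_completionI)
    then have "AE x in \<mu>. x \<notin> N'"
      unfolding \<mu>_def by (subst AE_restrict_space_iff) (auto elim: eventually_mono)
    then have "AE x in \<mu>. indicator A x *\<^sub>R h x = indicator B x *\<^sub>R h x"
      by eventually_elim (use A in \<open>auto simp: indicator_def\<close>)
    then have "(LINT x|\<mu>. indicator A x *\<^sub>R h x) = (LINT x|\<mu>. indicator B x *\<^sub>R h x)"
    proof (rule integral_cong_AE[rotated -1])
      show "(\<lambda>x. indicat_real A x *\<^sub>R h x) \<in> borel_measurable \<mu>"
        using \<open>A \<subseteq> _\<close> \<open>A \<in> sets \<mu>\<close> by (intro borel_measurable_integrable ind_int) (simp add: Int_absorb2)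
      show "(\<lambda>x. indicat_real B x *\<^sub>R h x) \<in> borel_measurable \<mu>"
        using A(4) by (intro borel_measurable_integrable ind_int borel_sets) simp
    qed
    also have "\<dots> = 0" using A(4) by (intro borel) simp
    finally show "set_lebesgue_integral \<mu> A h = 0" by (simp add: set_lebesgue_integral_def)
  qed
  then show ?thesis unfolding \<mu>_def .
qed

lemma AE_lebesgue_on_mono:
  assumes "AE x in lebesgue_on T. P x" "S \<subseteq> T" "S \<in> sets lebesgue" "T \<in> sets lebesgue"
  shows "AE x in lebesgue_on S. P x"
  using assms by (auto simp: AE_restrict_space_iff elim!: eventually_mono)

text \<open>Exhausting an open interval by intervals with closure inside it lets one pass from local to global
statements that hold almost everywhere.\<close>

lemma greaterThanLessThan_eq_UN_greaterThanLessThan: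
  fixes l r :: real
  shows "{l<..<r} = (\<Union>n. {l + 1 / real (Suc n)<..<r - 1 / real (Suc n)})"
proof (intro equalityI subsetI)
  fix x assume x: "x \<in> {l<..<r}"
  then obtain n where "inverse (real (Suc n)) < min (x - l) (r - x)"
    using reals_Archimedean[of "min (x - l) (r - x)"] by auto
  then have "x \<in> {l + 1 / real (Suc n)<..<r - 1 / real (Suc n)}"
    by (auto simp: inverse_eq_divide)
  then show "x \<in> (\<Union>n. {l + 1 / real (Suc n)<..<r - 1 / real (Suc n)})" by blast
next
  fix x assume "x \<in> (\<Union>n. {l + 1 / real (Suc n)<..<r - 1 / real (Suc n)})"
  then obtain n where "l + 1 / real (Suc n) < x" "x < r - 1 / real (Suc n)" by auto
  moreover have "1 / real (Suc n) > 0" by simp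
  ultimately show "x \<in> {l<..<r}" unfolding greaterThanLessThan_iff by linarith
qed

lemma integrable_lebesgue_on_subset:
  fixes f :: "real \<Rightarrow> 'b::{banach, second_countable_topology}"
  assumes "integrable (lebesgue_on T) f" "S \<subseteq> T" "S \<in> sets lebesgue" "T \<in> sets lebesgue"
  shows "integrable (lebesgue_on S) f"
  using assms set_integrable_subset[of lebesgue T f S]
  by (simp add: integrable_restrict_space set_integrable_def)

lemma integral_lebesgue_on_eq_subset:
  fixes f :: "real \<Rightarrow> 'b::{banach, second_countable_topology}"
  assumes "S \<subseteq> T" "S \<in> sets lebesgue" "T \<in> sets lebesgue" "\<And>x. x \<in> T - S \<Longrightarrow> f x = 0"
  shows "integral\<^sup>L (lebesgue_on T) f = integral\<^sup>L (lebesgue_on S) f"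
  using assms
  by (subst (1 2) integral_restrict_space)
    (auto intro!: Bochner_Integration.integral_cong simp: indicator_def)

text \<open>Testing with bumps and passing to the limit by dominated convergence shows that \<open>h\<close> has integral zero over
every interval inside.\<close>

lemma fundamental_lemma_calculus_of_variations:
  assumes loc: "locally_integrable {l<..<r} h"
    and zero: "\<And>\<phi>. test_function {l<..<r} \<phi> \<Longrightarrow>
      (LINT t|lebesgue_on {l<..<r}. \<phi> t *\<^sub>R h t) = 0"
  shows "AE t in lebesgue_on {l<..<r}. h t = 0"
proof -
  have sub: "AE t in lebesgue_on {a<..<b}. h t = 0" if ab: "l < a" "b < r" for a b
  proof (rule AE_zero_if_open_interval_integrals_zero)
    have "integrable (lebesgue_on {a..b}) h"
      using loc ab unfolding locally_integrable_def by (simp add: subset_iff)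
    then show int: "integrable (lebesgue_on {a<..<b}) h"
      by (rule integrable_lebesgue_on_subset) auto
    fix c d assume cd: "a \<le> c" "c < d" "d \<le> b"
    let ?\<phi> = "\<lambda>n. bump (real (Suc n)) c d"
    have "(LINT x|lebesgue_on {a<..<b}. ?\<phi> n x *\<^sub>R h x) = 0" for n
    proof -
      have "test_function {l<..<r} (\<lambda>x. ?\<phi> n x * 1)"
        by (rule test_function_mult_bump) (use ab cd in \<open>auto intro: elementary.intros\<close>)
      then have "(LINT x|lebesgue_on {l<..<r}. ?\<phi> n x *\<^sub>R h x) = 0" using zero by simp
      then show ?thesis
        by (subst (asm) integral_lebesgue_on_eq_subset[of "{a<..<b}"])
          (use ab cd in \<open>auto simp: bump_eq simp del: of_nat_Suc\<close>)
    qed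
    moreover have "(\<lambda>n. LINT x|lebesgue_on {a<..<b}. ?\<phi> n x *\<^sub>R h x) \<longlonglongrightarrow>
        (LINT x|lebesgue_on {a<..<b}. indicator {c<..<d} x *\<^sub>R h x)"
    proof (rule integral_dominated_convergence)
      show "integrable (lebesgue_on {a<..<b}) (\<lambda>x. cmod (h x))"
        using int by auto
      have "continuous_on {a<..<b} (?\<phi> n)" for n
        by (intro continuous_at_imp_continuous_on ballI
            DERIV_isCont[OF elementary_deriv(2)[OF elementary_bump]])
      then have "?\<phi> n \<in> borel_measurable (lebesgue_on {a<..<b})" for n
        by (intro continuous_imp_measurable_on_sets_lebesgue) auto
      then show "(\<lambda>x. ?\<phi> n x *\<^sub>R h x) \<in> borel_measurable (lebesgue_on {a<..<b})" for n
        using int by (intro borel_measurable_scaleR) auto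
      show "(\<lambda>x. indicator {c<..<d} x *\<^sub>R h x) \<in> borel_measurable (lebesgue_on {a<..<b})"
        using int cd by (intro borel_measurable_integrable integrable_mult_indicator)
          (auto simp: sets_restrict_space_iff)
      show "AE x in lebesgue_on {a<..<b}. (\<lambda>n. ?\<phi> n x *\<^sub>R h x) \<longlonglongrightarrow> indicator {c<..<d} x *\<^sub>R h x"
        by (intro AE_I2 tendsto_scaleR bump_tendsto_indicator tendsto_const)
      show "AE x in lebesgue_on {a<..<b}. norm (?\<phi> n x *\<^sub>R h x) \<le> cmod (h x)" for n
      proof (intro AE_I2)
        fix x
        have "\<bar>?\<phi> n x\<bar> \<le> 1" using bump_bounds[of "real (Suc n)" c d x] by simp
        then show "norm (?\<phi> n x *\<^sub>R h x) \<le> cmod (h x)" by (simp add: mult_left_le_one_le)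
      qed
    qed
    ultimately show "(LINT x|lebesgue_on {a<..<b}. indicator {c<..<d} x *\<^sub>R h x) = 0"
      using LIMSEQ_unique[OF _ tendsto_const] by simp
  qed
  have "AE t in lebesgue. \<forall>n. t \<in> {l + 1 / real (Suc n)<..<r - 1 / real (Suc n)} \<longrightarrow> h t = 0"
    unfolding AE_all_countable
  proof
    fix n
    show "AE t in lebesgue. t \<in> {l + 1 / real (Suc n)<..<r - 1 / real (Suc n)} \<longrightarrow> h t = 0"
    proof -
      have "AE t in lebesgue_on {l + 1 / real (Suc n)<..<r - 1 / real (Suc n)}. h t = 0"
        by (rule sub) auto
      then show ?thesis by (subst (asm) AE_restrict_space_iff) auto
    qed
  qed
  then show ?thesis
    by (subst AE_restrict_space_iff)
      (auto simp: greaterThanLessThan_eq_UN_greaterThanLessThan[of l r]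
        simp del: greaterThanLessThan_iff elim!: eventually_mono)
qed

section \<open>Local integrability and test functions\<close>

text \<open>The Lebesgue measure on a measurable set is complete, so a function that agrees almost everywhere with a
measurable one is measurable. This is needed because weak derivatives are only representatives chosen
arbitrarily up to null sets.\<close>

lemma measurable_lebesgue_on_cong_AE:
  assumes "S \<in> sets lebesgue" "f \<in> borel_measurable (lebesgue_on S)"
    and "AE x in lebesgue_on S. f x = g x"
  shows "g \<in> borel_measurable (lebesgue_on S)"
proof -
  interpret complete_measure "lebesgue_on S"
  proof
    fix A B assume "B \<subseteq> A" "A \<in> null_sets (lebesgue_on S)"
    then have "A \<in> null_sets lebesgue" "A \<subseteq> S"
      using assms(1) by (auto simp: null_sets_restrict_space)
    with \<open>B \<subseteq> A\<close> have "B \<in> sets lebesgue" "B \<subseteq> S"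
      using completion.complete[OF \<open>B \<subseteq> A\<close>] by blast+
    then show "B \<in> sets (lebesgue_on S)"
      using assms(1) by (simp add: sets_restrict_space_iff)
  qed
  show ?thesis
  proof (rule measurableI)
    fix A :: "'b set" assume "A \<in> sets borel"
    with assms(2) have meas: "f -` A \<inter> space (lebesgue_on S) \<in> sets (lebesgue_on S)"
      by (rule measurable_sets)
    have "AE x in lebesgue_on S. x \<in> f -` A \<inter> space (lebesgue_on S) \<longleftrightarrow>
        x \<in> g -` A \<inter> space (lebesgue_on S)"
      using assms(3) by eventually_elim auto
    from in_sets_AE[OF this meas] show "g -` A \<inter> space (lebesgue_on S) \<in> sets (lebesgue_on S)"
      by simp
  qed auto
qed

lemma integrable_lebesgue_on_cong_AE:
  fixes f g :: "real \<Rightarrow> 'b::{banach, second_countable_topology}"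
  assumes "S \<in> sets lebesgue" "integrable (lebesgue_on S) f" "AE x in lebesgue_on S. f x = g x"
  shows "integrable (lebesgue_on S) g"
  using integrable_cong_AE_imp[OF assms(2) measurable_lebesgue_on_cong_AE[OF assms(1) _ assms(3)] assms(3)]
    assms(2) by auto

lemma integrable_lebesgue_on_superset:
  fixes f :: "real \<Rightarrow> 'b::{banach, second_countable_topology}"
  assumes "integrable (lebesgue_on S) f" "S \<subseteq> T" "S \<in> sets lebesgue" "T \<in> sets lebesgue"
    "\<And>x. x \<in> T - S \<Longrightarrow> f x = 0"
  shows "integrable (lebesgue_on T) f"
proof -
  have "(\<lambda>x. indicator T x *\<^sub>R f x) = (\<lambda>x. indicator S x *\<^sub>R f x)"
    using assms(2,5) by (intro ext) (auto simp: indicator_def split: if_splits)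
  then show ?thesis using assms by (simp add: integrable_restrict_space)
qed

lemma integrable_scaleR_continuous:
  fixes g :: "real \<Rightarrow> complex" and w :: "real \<Rightarrow> real"
  assumes "compact K" "continuous_on K w" "integrable (lebesgue_on K) g"
  shows "integrable (lebesgue_on K) (\<lambda>t. w t *\<^sub>R g t)"
proof -
  obtain B where B: "\<And>t. t \<in> K \<Longrightarrow> \<bar>w t\<bar> \<le> B"
    using compact_imp_bounded[OF compact_continuous_image[OF assms(2,1)]]
    by (auto simp: bounded_iff)
  have K: "K \<in> sets lebesgue"
    using assms(1) by (simp add: lmeasurable_compact fmeasurableD)
  show ?thesis
  proof (rule Bochner_Integration.integrable_bound)
    show "integrable (lebesgue_on K) (\<lambda>t. B *\<^sub>R norm (g t))"
      using assms(3) by auto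
    show "(\<lambda>t. w t *\<^sub>R g t) \<in> borel_measurable (lebesgue_on K)"
      using continuous_imp_measurable_on_sets_lebesgue[OF assms(2) K] assms(3) by auto
    show "AE t in lebesgue_on K. norm (w t *\<^sub>R g t) \<le> norm (B *\<^sub>R norm (g t))"
    proof (intro AE_I2)
      fix t assume "t \<in> space (lebesgue_on K)"
      then have "\<bar>w t\<bar> \<le> \<bar>B\<bar>" using B[of t] by simp
      then show "norm (w t *\<^sub>R g t) \<le> norm (B *\<^sub>R norm (g t))"
        by (simp add: abs_mult mult_right_mono)
    qed
  qed
qed

lemma integrable_scaleR_compact_support:
  fixes g :: "real \<Rightarrow> complex" and w :: "real \<Rightarrow> real"
  assumes "locally_integrable I g" "I \<in> sets lebesgue" "continuous_on I w"
    and "compact K" "K \<subseteq> I" "\<And>t. t \<in> I - K \<Longrightarrow> w t = 0"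
  shows "integrable (lebesgue_on I) (\<lambda>t. w t *\<^sub>R g t)"
proof (rule integrable_lebesgue_on_superset)
  show "integrable (lebesgue_on K) (\<lambda>t. w t *\<^sub>R g t)"
    using assms by (intro integrable_scaleR_continuous)
      (auto simp: locally_integrable_def intro: continuous_on_subset)
  show "K \<in> sets lebesgue"
    using assms by (simp add: lmeasurable_compact fmeasurableD)
qed (use assms in auto)

lemma locally_integrable_scaleR_continuous:
  assumes "locally_integrable I g" "continuous_on I w"
  shows "locally_integrable I (\<lambda>t. w t *\<^sub>R g t)"
  unfolding locally_integrable_def
proof (intro allI impI)
  fix K assume "compact K \<and> K \<subseteq> I"
  then show "integrable (lebesgue_on K) (\<lambda>t. w t *\<^sub>R g t)"
    using assms by (intro integrable_scaleR_continuous)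
      (auto simp: locally_integrable_def intro: continuous_on_subset)
qed

lemma locally_integrable_add:
  "locally_integrable I g \<Longrightarrow> locally_integrable I h \<Longrightarrow> locally_integrable I (\<lambda>t. g t + h t)"
  by (auto simp: locally_integrable_def)

lemma locally_integrable_cmult:
  "locally_integrable I g \<Longrightarrow> locally_integrable I (\<lambda>t. c * g t)"
  by (auto simp: locally_integrable_def)

lemma locally_integrable_cong_AE:
  assumes "locally_integrable I g" "AE t in lebesgue_on I. g t = h t" "I \<in> sets lebesgue"
  shows "locally_integrable I h"
  unfolding locally_integrable_def
proof safe
  fix K assume K: "compact K" "K \<subseteq> I"
  then have Ks: "K \<in> sets lebesgue" by (simp add: lmeasurable_compact fmeasurableD)
  have "integrable (lebesgue_on K) g" using assms(1) K by (simp add: locally_integrable_def)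
  then show "integrable (lebesgue_on K) h"
    by (rule integrable_lebesgue_on_cong_AE[OF Ks _ AE_lebesgue_on_mono[OF assms(2) K(2) Ks assms(3)]])
qed

lemma test_function_deriv:
  assumes "test_function I \<phi>"
  shows "test_function I (deriv \<phi>)"
proof -
  obtain K where K: "compact K" "K \<subseteq> I" "\<And>x. x \<notin> K \<Longrightarrow> \<phi> x = 0"
    using assms by (auto simp: test_function_def)
  have "deriv \<phi> x = 0" if "x \<notin> K" for x
  proof (rule DERIV_imp_deriv)
    show "(\<phi> has_real_derivative 0) (at x)"
      by (rule has_field_derivative_transform_within_open[where S = "- K" and f = "\<lambda>_. 0"])
        (use K that in \<open>auto simp: open_Compl compact_imp_closed\<close>)
  qed
  moreover have "(deriv ^^ n) (deriv \<phi>) field_differentiable (at x)" for n x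
  proof -
    have "(deriv ^^ n) (deriv \<phi>) = (deriv ^^ Suc n) \<phi>" by (simp add: funpow_swap1)
    then show ?thesis using assms unfolding test_function_def by presburger
  qed
  ultimately show ?thesis using K unfolding test_function_def by blast
qed

lemma test_function_higher_deriv: "test_function I \<phi> \<Longrightarrow> test_function I ((deriv ^^ n) \<phi>)"
  by (induction n) (auto intro: test_function_deriv)

lemma test_function_has_deriv:
  assumes "test_function I \<phi>"
  shows "(\<phi> has_real_derivative deriv \<phi> x) (at x)"
  using assms unfolding test_function_def by (metis DERIV_deriv_iff_field_differentiable funpow_0)

lemma continuous_on_test_function:
  assumes "test_function I \<phi>"
  shows "continuous_on S \<phi>"
  by (intro continuous_at_imp_continuous_on ballI DERIV_isCont[OF test_function_has_deriv[OF assms]])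

lemma integrable_test_function:
  assumes "test_function I \<phi>" "locally_integrable I g" "I \<in> sets lebesgue"
  shows "integrable (lebesgue_on I) (\<lambda>t. \<phi> t *\<^sub>R g t)"
proof -
  obtain K where "compact K" "K \<subseteq> I" "\<And>x. x \<notin> K \<Longrightarrow> \<phi> x = 0"
    using assms by (auto simp: test_function_def)
  with assms show ?thesis
    by (intro integrable_scaleR_compact_support continuous_on_test_function) auto
qed

section \<open>Elementary properties of weak derivatives\<close>

lemma has_weak_deriv_cong_AE:
  assumes wd: "has_weak_deriv I j g h" and I: "I \<in> sets lebesgue"
    and g: "AE t in lebesgue_on I. g t = g' t" and h: "AE t in lebesgue_on I. h t = h' t"
  shows "has_weak_deriv I j g' h'"
proof -
  have loc: "locally_integrable I g" "locally_integrable I h"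
    using wd by (auto simp: has_weak_deriv_def)
  have loc': "locally_integrable I g'" "locally_integrable I h'"
    by (rule locally_integrable_cong_AE[OF loc(1) g I], rule locally_integrable_cong_AE[OF loc(2) h I])
  have eq: "(LINT t|lebesgue_on I. \<phi> t *\<^sub>R f' t) = (LINT t|lebesgue_on I. \<phi> t *\<^sub>R f t)"
    if "test_function I \<phi>" "locally_integrable I f" "locally_integrable I f'"
      "AE t in lebesgue_on I. f t = f' t" for \<phi> f f'
  proof (rule integral_cong_AE)
    show "AE t in lebesgue_on I. \<phi> t *\<^sub>R f' t = \<phi> t *\<^sub>R f t"
      using that(4) by eventually_elim simp
  qed (use integrable_test_function[OF that(1) _ I] that(2,3) in auto)
  show ?thesis
    unfolding has_weak_deriv_def
  proof (intro conjI loc' allI impI)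
    fix \<phi> assume \<phi>: "test_function I \<phi>"
    show "(LINT t|lebesgue_on I. (deriv ^^ j) \<phi> t *\<^sub>R g' t) =
        (- 1) ^ j * (LINT t|lebesgue_on I. \<phi> t *\<^sub>R h' t)"
      using wd \<phi> eq[OF test_function_higher_deriv[OF \<phi>] loc(1) loc'(1) g]
        eq[OF \<phi> loc(2) loc'(2) h] by (simp add: has_weak_deriv_def)
  qed
qed

text \<open>The chosen representatives are equal everywhere, since both functions have the same set of weak derivatives
to choose from.\<close>

lemma weak_deriv_cong_AE:
  assumes "AE t in lebesgue_on I. g t = g' t" "I \<in> sets lebesgue" "j > 0"
  shows "weak_deriv I j g = weak_deriv I j g'"
proof -
  have "AE t in lebesgue_on I. g' t = g t" using assms(1) by auto
  then have "has_weak_deriv I j g = has_weak_deriv I j g'"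
    using has_weak_deriv_cong_AE[OF _ assms(2) assms(1)] has_weak_deriv_cong_AE[OF _ assms(2)]
    by (intro ext iffI) blast+
  then show ?thesis using assms(3) by (simp add: weak_deriv_def)
qed

lemma has_weak_deriv_unique:
  assumes "has_weak_deriv {l<..<r} j g h" "has_weak_deriv {l<..<r} j g h'"
  shows "AE t in lebesgue_on {l<..<r}. h t = h' t"
proof -
  let ?I = "{l<..<r}"
  have loc: "locally_integrable ?I h" "locally_integrable ?I h'"
    using assms by (auto simp: has_weak_deriv_def)
  have "AE t in lebesgue_on ?I. h t - h' t = 0"
  proof (rule fundamental_lemma_calculus_of_variations)
    show "locally_integrable ?I (\<lambda>t. h t - h' t)"
      using locally_integrable_add[OF loc(1) locally_integrable_cmult[OF loc(2), of "-1"]] by simp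
    fix \<phi> assume \<phi>: "test_function ?I \<phi>"
    then have "(- 1) ^ j * (LINT t|lebesgue_on ?I. \<phi> t *\<^sub>R h t) =
        (- 1) ^ j * (LINT t|lebesgue_on ?I. \<phi> t *\<^sub>R h' t)"
      using assms \<phi> unfolding has_weak_deriv_def by (auto dest!: spec[of _ \<phi>])
    then have "(LINT t|lebesgue_on ?I. \<phi> t *\<^sub>R h t) = (LINT t|lebesgue_on ?I. \<phi> t *\<^sub>R h' t)" by simp
    then show "(LINT t|lebesgue_on ?I. \<phi> t *\<^sub>R (h t - h' t)) = 0"
      using integrable_test_function[OF \<phi>] loc by (simp add: scaleR_diff_right)
  qed
  then show ?thesis by simp
qed

lemma has_weak_deriv_weak_deriv:
  assumes "has_weak_deriv I j g h" "j > 0"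
  shows "has_weak_deriv I j g (weak_deriv I j g)"
  using someI[of "has_weak_deriv I j g", OF assms(1)] assms(2) by (simp add: weak_deriv_def)

lemma weak_deriv_AE_eq:
  assumes "has_weak_deriv {l<..<r} j g h" "j > 0"
  shows "AE t in lebesgue_on {l<..<r}. weak_deriv {l<..<r} j g t = h t"
  by (rule has_weak_deriv_unique[OF has_weak_deriv_weak_deriv[OF assms] assms(1)])

lemma has_weak_deriv_add:
  assumes "has_weak_deriv I j g h" "has_weak_deriv I j g' h'" "I \<in> sets lebesgue"
  shows "has_weak_deriv I j (\<lambda>t. g t + g' t) (\<lambda>t. h t + h' t)"
  unfolding has_weak_deriv_def
proof (intro conjI allI impI)
  have loc: "locally_integrable I g" "locally_integrable I h"
    "locally_integrable I g'" "locally_integrable I h'"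
    using assms by (auto simp: has_weak_deriv_def)
  then show "locally_integrable I (\<lambda>t. g t + g' t)" "locally_integrable I (\<lambda>t. h t + h' t)"
    by (auto intro: locally_integrable_add)
  fix \<phi> assume \<phi>: "test_function I \<phi>"
  have "(LINT t|lebesgue_on I. \<psi> t *\<^sub>R (u t + v t)) =
      (LINT t|lebesgue_on I. \<psi> t *\<^sub>R u t) + (LINT t|lebesgue_on I. \<psi> t *\<^sub>R v t)"
    if "test_function I \<psi>" "locally_integrable I u" "locally_integrable I v" for \<psi> u v
    using integrable_test_function[OF that(1) _ assms(3)] that(2,3) by (simp add: scaleR_add_right)
  note add = this
  have "(LINT t|lebesgue_on I. (deriv ^^ j) \<phi> t *\<^sub>R g t) = (- 1) ^ j * (LINT t|lebesgue_on I. \<phi> t *\<^sub>R h t)"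
    "(LINT t|lebesgue_on I. (deriv ^^ j) \<phi> t *\<^sub>R g' t) = (- 1) ^ j * (LINT t|lebesgue_on I. \<phi> t *\<^sub>R h' t)"
    using assms(1,2) \<phi> unfolding has_weak_deriv_def by blast+
  then show "(LINT t|lebesgue_on I. (deriv ^^ j) \<phi> t *\<^sub>R (g t + g' t)) =
      (- 1) ^ j * (LINT t|lebesgue_on I. \<phi> t *\<^sub>R (h t + h' t))"
    unfolding add[OF test_function_higher_deriv[OF \<phi>] loc(1,3)] add[OF \<phi> loc(2,4)]
    by (simp only: distrib_left)
qed

lemma has_weak_deriv_cmult:
  assumes "has_weak_deriv I j g h"
  shows "has_weak_deriv I j (\<lambda>t. c * g t) (\<lambda>t. c * h t)"
  unfolding has_weak_deriv_def
proof (intro conjI allI impI)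
  show "locally_integrable I (\<lambda>t. c * g t)" "locally_integrable I (\<lambda>t. c * h t)"
    using assms by (auto simp: has_weak_deriv_def intro: locally_integrable_cmult)
  fix \<phi> assume \<phi>: "test_function I \<phi>"
  have "(LINT t|lebesgue_on I. \<psi> t *\<^sub>R (c * u t)) = c * (LINT t|lebesgue_on I. \<psi> t *\<^sub>R u t)" for \<psi> u
    by (simp flip: mult_scaleR_right)
  moreover have "(LINT t|lebesgue_on I. (deriv ^^ j) \<phi> t *\<^sub>R g t) =
      (- 1) ^ j * (LINT t|lebesgue_on I. \<phi> t *\<^sub>R h t)"
    using assms \<phi> unfolding has_weak_deriv_def by blast
  ultimately show "(LINT t|lebesgue_on I. (deriv ^^ j) \<phi> t *\<^sub>R (c * g t)) =
      (- 1) ^ j * (LINT t|lebesgue_on I. \<phi> t *\<^sub>R (c * h t))"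
    by (simp only: mult.left_commute)
qed

text \<open>Both identities are tested with functions derived from one \<open>\<phi>\<close>: that for \<open>h\<close> with \<open>\<phi>'\<close>, that for \<open>h'\<close> with \<open>\<phi>\<close>
itself.\<close>

lemma has_weak_deriv_1_of_2:
  assumes "has_weak_deriv I 1 g h" "has_weak_deriv I 2 g h'"
  shows "has_weak_deriv I 1 h h'"
  unfolding has_weak_deriv_def
proof (intro conjI allI impI)
  show "locally_integrable I h" "locally_integrable I h'"
    using assms by (auto simp: has_weak_deriv_def)
  fix \<phi> assume \<phi>: "test_function I \<phi>"
  have "(LINT t|lebesgue_on I. (deriv ^^ 1) (deriv \<phi>) t *\<^sub>R g t) =
      (- 1) ^ 1 * (LINT t|lebesgue_on I. deriv \<phi> t *\<^sub>R h t)"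
    using assms(1) test_function_deriv[OF \<phi>] unfolding has_weak_deriv_def by blast
  moreover have "(LINT t|lebesgue_on I. (deriv ^^ 2) \<phi> t *\<^sub>R g t) =
      (- 1)\<^sup>2 * (LINT t|lebesgue_on I. \<phi> t *\<^sub>R h' t)"
    using assms(2) \<phi> unfolding has_weak_deriv_def by blast
  moreover have "(deriv ^^ 2) \<phi> = (deriv ^^ 1) (deriv \<phi>)"
    by (simp add: numeral_2_eq_2)
  ultimately have "- (LINT t|lebesgue_on I. deriv \<phi> t *\<^sub>R h t) = (LINT t|lebesgue_on I. \<phi> t *\<^sub>R h' t)"
    by (simp only: power_one_right power2_minus power_one mult_1_left mult_minus1)
  then show "(LINT t|lebesgue_on I. (deriv ^^ 1) \<phi> t *\<^sub>R h t) =
      (- 1) ^ 1 * (LINT t|lebesgue_on I. \<phi> t *\<^sub>R h' t)"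
    by (simp add: equation_minus_iff)
qed

section \<open>The product rule for weak derivatives\<close>

lemma real_polynomial_function_antiderivative:
  fixes f :: "real \<Rightarrow> real"
  assumes "real_polynomial_function f"
  obtains F where "real_polynomial_function F" "\<And>x. (F has_real_derivative f x) (at x)" "F c = y"
proof -
  obtain a n where f: "f = (\<lambda>x. \<Sum>i\<le>n. a i * x ^ i)"
    using assms by (auto simp: real_polynomial_function_iff_sum)
  define G where "G = (\<lambda>x::real. \<Sum>i\<le>n. a i / real (Suc i) * x ^ Suc i)"
  have "real_polynomial_function G"
    unfolding G_def
    by (intro real_polynomial_function_sum real_polynomial_function.intros
        real_polynomial_function_power) auto
  then have "real_polynomial_function (\<lambda>x. G x + (y - G c))"
    by (intro real_polynomial_function.intros(2,3))
  moreover have "(G has_real_derivative f x) (at x)" for x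
    unfolding G_def f
    by (rule derivative_eq_intros refl | simp add: mult.commute del: of_nat_Suc power_Suc)+
  then have "((\<lambda>x. G x + (y - G c)) has_real_derivative f x) (at x)" for x
    by (auto intro!: derivative_eq_intros)
  ultimately show thesis by (rule that[of "\<lambda>x. G x + (y - G c)"]) simp_all
qed

text \<open>The derivative is approximated uniformly by Stone-Weierstrass, and the antiderivative of the approximating
polynomial with the right value at \<open>c\<close> is then close to the function by the mean value theorem.\<close>

lemma C1_polynomial_approximation:
  fixes \<psi> \<psi>' :: "real \<Rightarrow> real"
  assumes "c \<le> d" "\<And>x. x \<in> {c..d} \<Longrightarrow> (\<psi> has_real_derivative \<psi>' x) (at x within {c..d})"
    and "continuous_on {c..d} \<psi>'" "e > 0"
  obtains q q' where "real_polynomial_function q" "\<And>x. (q has_real_derivative q' x) (at x)"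
    "\<And>x. x \<in> {c..d} \<Longrightarrow> \<bar>q' x - \<psi>' x\<bar> \<le> e" "\<And>x. x \<in> {c..d} \<Longrightarrow> \<bar>q x - \<psi> x\<bar> \<le> e * (d - c)"
proof -
  obtain q' where q': "real_polynomial_function q'" "\<And>x. x \<in> {c..d} \<Longrightarrow> \<bar>\<psi>' x - q' x\<bar> < e"
    by (rule Stone_Weierstrass_real_polynomial_function[OF compact_Icc assms(3,4)]) blast
  obtain q where q: "real_polynomial_function q" "\<And>x. (q has_real_derivative q' x) (at x)" "q c = \<psi> c"
    by (rule real_polynomial_function_antiderivative[OF q'(1), of c "\<psi> c"]) blast
  have close: "\<bar>q' x - \<psi>' x\<bar> \<le> e" if "x \<in> {c..d}" for x
    using q'(2)[OF that] by linarith
  have "\<bar>q x - \<psi> x\<bar> \<le> e * (d - c)" if x: "x \<in> {c..d}" for x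
  proof -
    have "norm ((q x - \<psi> x) - (q c - \<psi> c)) \<le> e * norm (x - c)"
    proof (rule field_differentiable_bound[where S = "{c..d}" and f' = "\<lambda>x. q' x - \<psi>' x"])
      fix z assume "z \<in> {c..d}"
      then show "((\<lambda>x. q x - \<psi> x) has_real_derivative q' z - \<psi>' z) (at z within {c..d})"
        by (intro DERIV_diff assms(2) has_field_derivative_at_within[OF q(2)])
    qed (use x close assms(1) in auto)
    also have "\<dots> \<le> e * (d - c)"
      using x assms(4) by (intro mult_left_mono) auto
    finally show ?thesis using q(3) by simp
  qed
  with close q that show thesis by blast
qed

lemma compact_subset_open_interval:
  fixes K :: "real set"
  assumes "compact K" "K \<subseteq> {l<..<r}" "l < r"
  obtains c d where "l < c" "c < d" "d < r" "K \<subseteq> {c..d}"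
proof (cases "K = {}")
  case True
  obtain c where "l < c" "c < r" using dense[OF assms(3)] by blast
  moreover then obtain d where "c < d" "d < r" using dense by blast
  ultimately show thesis using that True by blast
next
  case False
  obtain m where m: "m \<in> K" "\<And>t. t \<in> K \<Longrightarrow> m \<le> t" using compact_attains_inf[OF assms(1) False] by blast
  obtain M where M: "M \<in> K" "\<And>t. t \<in> K \<Longrightarrow> t \<le> M" using compact_attains_sup[OF assms(1) False] by blast
  have "l < m" "m \<le> M" "M < r" using assms(2) m M by auto
  moreover obtain c where "l < c" "c < m" using dense[OF \<open>l < m\<close>] by blast
  moreover have "K \<subseteq> {c..M}" using m M \<open>c < m\<close> by force
  ultimately show thesis using that[of c M] by simp
qed

text \<open>Let \<open>b\<close> be a bump that is positive on a neighbourhood of the support of \<open>\<psi>\<close>. Then \<open>\<psi> = b \<eta>\<close> with \<open>\<eta>\<close> continuously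
differentiable. If the polynomials \<open>q\<^sub>n\<close> approximate \<open>\<eta>\<close> in \<open>C\<^sup>1\<close>, then \<open>b q\<^sub>n\<close> are test functions that
approximate \<open>\<psi>\<close> in \<open>C\<^sup>1\<close>, with supports in a common compact interval, and one passes to the limit. The
factor \<open>b\<close> provides compact support without the need for a smooth function that is constant on an interval.\<close>

lemma has_weak_deriv_C1_test_function:
  fixes \<psi> \<psi>' :: "real \<Rightarrow> real"
  assumes wd: "has_weak_deriv {l<..<r} 1 g h"
    and K: "compact K" "K \<subseteq> {l<..<r}" "\<And>t. t \<notin> K \<Longrightarrow> \<psi> t = 0" 
    and deriv: "\<And>t. (\<psi> has_real_derivative \<psi>' t) (at t)" and cont: "continuous_on UNIV \<psi>'"
  shows "(LINT t|lebesgue_on {l<..<r}. \<psi>' t *\<^sub>R g t) = - (LINT t|lebesgue_on {l<..<r}. \<psi> t *\<^sub>R h t)"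
proof (cases "l < r")
  case False
  then show ?thesis by simp
next
  case True
  let ?I = "{l<..<r}"
  obtain c d where cd: "l < c" "c < d" "d < r" "K \<subseteq> {c..d}"
    using compact_subset_open_interval[OF K(1,2) True] by metis
  obtain c' where c': "l < c'" "c' < c" using dense[OF cd(1)] by blast
  obtain d' where d': "d < d'" "d' < r" using dense[OF cd(3)] by blast
  let ?J = "{c'..d'}"
  have outside: "\<psi> t = 0" if "t \<notin> {c..d}" for t using K(3) cd(4) that by blast
  have outside': "\<psi>' t = 0" if "t \<notin> {c..d}" for t
  proof -
    have "(\<psi> has_real_derivative 0) (at t)"
      by (rule has_field_derivative_transform_within_open[where S = "- {c..d}" and f = "\<lambda>_. 0"])
        (use outside that in \<open>auto simp: open_Compl\<close>)
    with deriv show ?thesis using DERIV_unique by blast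
  qed
  \<comment> \<open>The support of the bump exceeds that of \<open>\<psi>\<close> on both sides, so that the quotient \<open>\<psi> / b\<close> has no
    singularity: at each point \<open>b\<close> is positive or \<open>\<psi>\<close> vanishes nearby.\<close>
  define b where "b = bump 1 c' d'"
  define b' where "b' = deriv b"
  have b: "elementary b" "elementary b'" "\<And>t. (b has_real_derivative b' t) (at t)"
    using elementary_bump[of 1 c' d'] elementary_deriv unfolding b_def b'_def by auto
  have bpos: "b t > 0" if "t \<in> {c..d}" for t
    using that c' d' unfolding b_def by (simp add: bump_eq)
  have bcont: "continuous_on S f" if "elementary f" for f S
    by (intro continuous_at_imp_continuous_on ballI DERIV_isCont[OF elementary_deriv(2)[OF that]])
  define \<eta> where "\<eta> = (\<lambda>t. \<psi> t / b t)"
  define \<eta>' where "\<eta>' = (\<lambda>t. (\<psi>' t * b t - \<psi> t * b' t) / (b t * b t))"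
  have prod: "\<psi> t = b t * \<eta> t" "\<psi>' t = b' t * \<eta> t + b t * \<eta>' t" for t
    using outside[of t] outside'[of t] bpos[of t] unfolding \<eta>_def \<eta>'_def
    by (cases "t \<in> {c..d}"; simp add: field_simps)+
  have U: "open (- {c..d})" "\<And>t. t \<in> - {c..d} \<Longrightarrow> \<eta> t = 0 \<and> \<eta>' t = 0"
    using outside outside' by (auto simp: open_Compl \<eta>_def \<eta>'_def)
  have V: "t \<in> - {c..d} \<or> b t > 0" for t using bpos[of t] by blast
  have \<eta>_deriv: "(\<eta> has_real_derivative \<eta>' t) (at t)" for t
  proof (cases "b t > 0")
    case True
    then show ?thesis unfolding \<eta>_def \<eta>'_def
      by (intro DERIV_divide deriv b) auto
  next
    case False
    with V have "t \<in> - {c..d}" by blast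
    show ?thesis
      by (rule has_field_derivative_transform_within_open[where S = "- {c..d}" and f = "\<lambda>_. 0"])
        (use U \<open>t \<in> - {c..d}\<close> in auto)
  qed
  have \<eta>'_cont: "isCont \<eta>' t" for t
  proof (cases "b t > 0")
    case True
    have "isCont f t" if "elementary f" for f
      by (rule DERIV_isCont[OF elementary_deriv(2)[OF that]])
    moreover have "isCont \<psi> t" "isCont \<psi>' t"
      using DERIV_isCont[OF deriv] cont by (auto simp: continuous_on_eq_continuous_at)
    ultimately show ?thesis
      unfolding \<eta>'_def using True b(1,2) by (intro continuous_intros) auto
  next
    case False
    with V have "t \<in> - {c..d}" by blast
    then have "eventually (\<lambda>s. \<eta>' s = 0) (nhds t)"
      using U by (auto simp: eventually_nhds)
    then show ?thesis
      by (subst isCont_cong[where g = "\<lambda>_. 0"]) auto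
  qed
  have "\<exists>q q'. real_polynomial_function q \<and> (\<forall>x. (q has_real_derivative q' x) (at x)) \<and>
      (\<forall>x\<in>?J. \<bar>q' x - \<eta>' x\<bar> \<le> 1 / real (Suc n)) \<and>
      (\<forall>x\<in>?J. \<bar>q x - \<eta> x\<bar> \<le> 1 / real (Suc n) * (d' - c'))" for n
  proof -
    have "c' \<le> d'" "1 / real (Suc n) > 0" using c' d' cd by auto
    moreover have "continuous_on ?J \<eta>'"
      using \<eta>'_cont by (simp add: continuous_at_imp_continuous_on)
    ultimately obtain q q' where "real_polynomial_function q" "\<And>x. (q has_real_derivative q' x) (at x)"
      "\<And>x. x \<in> ?J \<Longrightarrow> \<bar>q' x - \<eta>' x\<bar> \<le> 1 / real (Suc n)"
      "\<And>x. x \<in> ?J \<Longrightarrow> \<bar>q x - \<eta> x\<bar> \<le> 1 / real (Suc n) * (d' - c')"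
      using C1_polynomial_approximation[of c' d' \<eta> \<eta>' "1 / real (Suc n)"]
        has_field_derivative_at_within[OF \<eta>_deriv] by metis
    then show ?thesis by blast
  qed
  then obtain q q' where q: "\<And>n. real_polynomial_function (q n)"
      "\<And>n x. (q n has_real_derivative q' n x) (at x)"
      "\<And>n x. x \<in> ?J \<Longrightarrow> \<bar>q' n x - \<eta>' x\<bar> \<le> 1 / real (Suc n)"
      "\<And>n x. x \<in> ?J \<Longrightarrow> \<bar>q n x - \<eta> x\<bar> \<le> 1 / real (Suc n) * (d' - c')"
    by metis
  define \<phi> where "\<phi> = (\<lambda>n t. b t * q n t)"
  define \<phi>' where "\<phi>' = (\<lambda>n t. b' t * q n t + b t * q' n t)"
  have \<phi>: "test_function ?I (\<phi> n)" for n
    unfolding \<phi>_def b_def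
    by (rule test_function_mult_bump) (use c' d' in \<open>auto intro: elementary_polynomial q\<close>)
  have \<phi>': "deriv (\<phi> n) = \<phi>' n" for n
    unfolding \<phi>_def \<phi>'_def
    by (intro ext DERIV_imp_deriv DERIV_cong[OF DERIV_mult[OF b(3) q(2)]]) (simp add: algebra_simps)
  have parts: "(LINT t|lebesgue_on ?I. \<phi>' n t *\<^sub>R g t) = - (LINT t|lebesgue_on ?I. \<phi> n t *\<^sub>R h t)" for n
    using wd \<phi>[of n] unfolding has_weak_deriv_def by (simp flip: \<phi>')
  obtain B where B: "\<And>t. t \<in> ?J \<Longrightarrow> \<bar>b t\<bar> \<le> B" "\<And>t. t \<in> ?J \<Longrightarrow> \<bar>b' t\<bar> \<le> B"
  proof -
    have "\<exists>C. \<forall>t\<in>?J. \<bar>f t\<bar> \<le> C" if "elementary f" for f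
      using compact_imp_bounded[OF compact_continuous_image[OF bcont[OF that, of ?J] compact_Icc]]
      by (auto simp: bounded_iff)
    then obtain B1 B2 where "\<forall>t\<in>?J. \<bar>b t\<bar> \<le> B1" "\<forall>t\<in>?J. \<bar>b' t\<bar> \<le> B2"
      using b(1,2) by meson
    then show thesis using that[of "max B1 B2"] by (meson max.coboundedI1 max.coboundedI2)
  qed
  have B0: "B \<ge> 0" using B(1)[of c'] c' d' cd by force
  \<comment> \<open>Integrals against a locally integrable function converge if the factors, supported in the compact
    interval, converge uniformly there at the rate \<open>1 / n\<close>.\<close>
  have lim: "(\<lambda>n. LINT t|lebesgue_on ?I. f n t *\<^sub>R u t) \<longlonglongrightarrow> (LINT t|lebesgue_on ?I. f0 t *\<^sub>R u t)"
    if u: "locally_integrable ?I u" and f: "\<And>n. continuous_on ?J (f n)" "continuous_on ?J f0"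
      and z: "\<And>n t. t \<notin> ?J \<Longrightarrow> f n t = 0" "\<And>t. t \<notin> ?J \<Longrightarrow> f0 t = 0"
      and C: "\<And>n t. t \<in> ?J \<Longrightarrow> \<bar>f n t - f0 t\<bar> \<le> C * (1 / real (Suc n))"
    for u f f0 C
  proof -
    have red: "(LINT t|lebesgue_on ?I. k t *\<^sub>R u t) = (LINT t|lebesgue_on ?J. k t *\<^sub>R u t)"
      if "\<And>t. t \<notin> ?J \<Longrightarrow> k t = 0" for k
      by (rule integral_lebesgue_on_eq_subset) (use c' d' that in auto)
    have int: "integrable (lebesgue_on ?J) u"
      using u c' d' unfolding locally_integrable_def by (simp add: subset_iff)
    have "(\<lambda>n. LINT t|lebesgue_on ?J. f n t *\<^sub>R u t) \<longlonglongrightarrow> (LINT t|lebesgue_on ?J. f0 t *\<^sub>R u t)"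
    proof (rule Lim_null_comparison[THEN LIM_zero_cancel])
      show "(\<lambda>n. (C * (LINT t|lebesgue_on ?J. cmod (u t))) * (1 / real (Suc n))) \<longlonglongrightarrow> 0"
        using tendsto_mult_left[OF LIMSEQ_inverse_real_of_nat] by (simp add: inverse_eq_divide)
      show "\<forall>\<^sub>F n in sequentially. norm ((LINT t|lebesgue_on ?J. f n t *\<^sub>R u t) - (LINT t|lebesgue_on ?J. f0 t *\<^sub>R u t))
          \<le> (C * (LINT t|lebesgue_on ?J. cmod (u t))) * (1 / real (Suc n))"
      proof (intro always_eventually allI)
        fix n
        have i: "integrable (lebesgue_on ?J) (\<lambda>t. f n t *\<^sub>R u t)" "integrable (lebesgue_on ?J) (\<lambda>t. f0 t *\<^sub>R u t)"
          by (intro integrable_scaleR_continuous compact_Icc f int)+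
        have "norm ((LINT t|lebesgue_on ?J. f n t *\<^sub>R u t) - (LINT t|lebesgue_on ?J. f0 t *\<^sub>R u t)) =
            norm (LINT t|lebesgue_on ?J. f n t *\<^sub>R u t - f0 t *\<^sub>R u t)"
          using i by simp
        also have "\<dots> \<le> (LINT t|lebesgue_on ?J. norm (f n t *\<^sub>R u t - f0 t *\<^sub>R u t))"
          by (rule integral_norm_bound)
        also have "\<dots> \<le> (LINT t|lebesgue_on ?J. (C * (1 / real (Suc n))) * cmod (u t))"
        proof (rule integral_mono)
          show "integrable (lebesgue_on ?J) (\<lambda>t. norm (f n t *\<^sub>R u t - f0 t *\<^sub>R u t))" using i by auto
          show "integrable (lebesgue_on ?J) (\<lambda>t. (C * (1 / real (Suc n))) * cmod (u t))" using int by auto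
          fix t assume "t \<in> space (lebesgue_on ?J)"
          then have "\<bar>f n t - f0 t\<bar> * cmod (u t) \<le> (C * (1 / real (Suc n))) * cmod (u t)"
            by (intro mult_right_mono C) auto
          then show "norm (f n t *\<^sub>R u t - f0 t *\<^sub>R u t) \<le> (C * (1 / real (Suc n))) * cmod (u t)"
            by (simp flip: scaleR_diff_left)
        qed
        finally show "norm ((LINT t|lebesgue_on ?J. f n t *\<^sub>R u t) - (LINT t|lebesgue_on ?J. f0 t *\<^sub>R u t))
          \<le> (C * (LINT t|lebesgue_on ?J. cmod (u t))) * (1 / real (Suc n))" by (simp add: mult_ac)
      qed
    qed
    then show ?thesis using red z by simp
  qed
  have b_zero: "b t = 0" "b' t = 0" if "t \<notin> ?J" for t
  proof -
    show "b t = 0" using that by (auto simp: b_def bump_eq)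
    have "(b has_real_derivative 0) (at t)"
      by (rule has_field_derivative_transform_within_open[where S = "- ?J" and f = "\<lambda>_. 0"])
        (use that in \<open>auto simp: open_Compl b_def bump_eq\<close>)
    then show "b' t = 0" using b(3) DERIV_unique by blast
  qed
  have q_cont: "continuous_on S (q n)" "continuous_on S (q' n)" for S n
  proof -
    have "q' n = deriv (q n)" by (intro ext DERIV_imp_deriv[symmetric] q)
    then show "continuous_on S (q n)" "continuous_on S (q' n)"
      using bcont elementary_polynomial[OF q(1)] elementary_deriv(1) by auto
  qed
  have \<eta>_cont: "continuous_on S \<eta>" "continuous_on S \<eta>'" for S
    using DERIV_isCont[OF \<eta>_deriv] \<eta>'_cont by (auto intro: continuous_at_imp_continuous_on)
  have loc: "locally_integrable ?I g" "locally_integrable ?I h"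
    using wd by (auto simp: has_weak_deriv_def)
  have "(\<lambda>n. LINT t|lebesgue_on ?I. \<phi> n t *\<^sub>R h t) \<longlonglongrightarrow> (LINT t|lebesgue_on ?I. \<psi> t *\<^sub>R h t)"
  proof (rule lim[where C = "B * (d' - c')"])
    show "\<bar>\<phi> n t - \<psi> t\<bar> \<le> B * (d' - c') * (1 / real (Suc n))" if "t \<in> ?J" for n t
    proof -
      have "\<bar>\<phi> n t - \<psi> t\<bar> = \<bar>b t\<bar> * \<bar>q n t - \<eta> t\<bar>"
        unfolding \<phi>_def prod(1) by (simp flip: abs_mult right_diff_distrib)
      also have "\<dots> \<le> B * (1 / real (Suc n) * (d' - c'))"
        using B0 by (intro mult_mono B(1) q(4) that) auto
      finally show ?thesis by (simp add: mult_ac)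
    qed
    show "continuous_on ?J (\<phi> n)" for n
      unfolding \<phi>_def by (intro continuous_intros q_cont bcont b)
    show "continuous_on ?J \<psi>"
      by (intro continuous_at_imp_continuous_on ballI DERIV_isCont[OF deriv])
  qed (use loc b_zero prod(1) in \<open>auto simp: \<phi>_def\<close>)
  moreover have "(\<lambda>n. LINT t|lebesgue_on ?I. \<phi>' n t *\<^sub>R g t) \<longlonglongrightarrow> (LINT t|lebesgue_on ?I. \<psi>' t *\<^sub>R g t)"
  proof (rule lim[where C = "B * (d' - c') + B"])
    show "\<bar>\<phi>' n t - \<psi>' t\<bar> \<le> (B * (d' - c') + B) * (1 / real (Suc n))" if "t \<in> ?J" for n t
    proof -
      have "\<phi>' n t - \<psi>' t = b' t * (q n t - \<eta> t) + b t * (q' n t - \<eta>' t)"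
        unfolding \<phi>'_def prod(2) by (simp add: algebra_simps)
      then have "\<bar>\<phi>' n t - \<psi>' t\<bar> \<le> \<bar>b' t\<bar> * \<bar>q n t - \<eta> t\<bar> + \<bar>b t\<bar> * \<bar>q' n t - \<eta>' t\<bar>"
        by (metis abs_mult abs_triangle_ineq)
      also have "\<dots> \<le> B * (1 / real (Suc n) * (d' - c')) + B * (1 / real (Suc n))"
        using B0 by (intro add_mono mult_mono B q(3,4) that) auto
      also have "\<dots> = (B * (d' - c') + B) * (1 / real (Suc n))"
      proof -
        have "B * (s * x) + B * s = (B * x + B) * s" for s x by (simp add: algebra_simps)
        then show ?thesis .
      qed
      finally show ?thesis .
    qed
    show "continuous_on ?J (\<phi>' n)" for n
      unfolding \<phi>'_def by (intro continuous_intros q_cont bcont b)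
    show "continuous_on ?J \<psi>'" using cont by (rule continuous_on_subset) auto
  qed (use loc b_zero prod(2) in \<open>auto simp: \<phi>'_def\<close>)
  ultimately show ?thesis
    using LIMSEQ_unique tendsto_minus unfolding parts by blast
qed

text \<open>If \<open>\<phi>\<close> is a test function, then \<open>\<phi> w\<close>, extended by zero, is a continuously differentiable function of compact
support, and \<open>\<phi>' w = (\<phi> w)' - \<phi> w'\<close>.\<close>

lemma has_weak_deriv_scaleR:
  fixes w w' :: "real \<Rightarrow> real"
  assumes wd: "has_weak_deriv {l<..<r} 1 g h"
    and w: "\<And>t. t \<in> {l<..<r} \<Longrightarrow> (w has_real_derivative w' t) (at t)"
    and cont: "continuous_on {l<..<r} w'"
  shows "has_weak_deriv {l<..<r} 1 (\<lambda>t. w t *\<^sub>R g t) (\<lambda>t. w t *\<^sub>R h t + w' t *\<^sub>R g t)"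
  unfolding has_weak_deriv_def
proof (intro conjI allI impI)
  let ?I = "{l<..<r}"
  have loc: "locally_integrable ?I g" "locally_integrable ?I h"
    using wd by (auto simp: has_weak_deriv_def)
  have w_cont: "continuous_on ?I w"
    by (intro continuous_at_imp_continuous_on ballI DERIV_isCont[OF w])
  show wg: "locally_integrable ?I (\<lambda>t. w t *\<^sub>R g t)"
    by (intro locally_integrable_scaleR_continuous loc w_cont)
  have w'g: "locally_integrable ?I (\<lambda>t. w' t *\<^sub>R g t)" and wh: "locally_integrable ?I (\<lambda>t. w t *\<^sub>R h t)"
    by (intro locally_integrable_scaleR_continuous loc cont w_cont)+
  show "locally_integrable ?I (\<lambda>t. w t *\<^sub>R h t + w' t *\<^sub>R g t)"
    by (intro locally_integrable_add wh w'g)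
  fix \<phi> assume \<phi>: "test_function ?I \<phi>"
  obtain K where K: "compact K" "K \<subseteq> ?I" "\<And>x. x \<notin> K \<Longrightarrow> \<phi> x = 0"
    using \<phi> by (auto simp: test_function_def)
  have K': "deriv \<phi> x = 0" if "x \<notin> K" for x
  proof (rule DERIV_imp_deriv)
    show "(\<phi> has_real_derivative 0) (at x)"
      by (rule has_field_derivative_transform_within_open[where S = "- K" and f = "\<lambda>_. 0"])
        (use K that in \<open>auto simp: open_Compl compact_imp_closed\<close>)
  qed
  \<comment> \<open>Outside the interval \<open>w\<close> and \<open>w'\<close> are arbitrary, but there the factors \<open>\<phi>\<close> and \<open>deriv \<phi>\<close> vanish.\<close>
  define \<psi>' where "\<psi>' = (\<lambda>t. deriv \<phi> t * w t + w' t * \<phi> t)"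
  have cases: "t \<in> ?I \<or> t \<in> - K" for t using K(2) by blast
  have openK: "open (- K)" using K(1) by (simp add: open_Compl compact_imp_closed)
  have "(LINT t|lebesgue_on ?I. \<psi>' t *\<^sub>R g t) = - (LINT t|lebesgue_on ?I. (\<phi> t * w t) *\<^sub>R h t)"
  proof (rule has_weak_deriv_C1_test_function[OF wd K(1,2)])
    show "\<phi> t * w t = 0" if "t \<notin> K" for t using K(3) that by simp
    show "((\<lambda>t. \<phi> t * w t) has_real_derivative \<psi>' t) (at t)" for t
    proof (cases "t \<in> ?I")
      case True
      then show ?thesis unfolding \<psi>'_def by (intro DERIV_mult w test_function_has_deriv[OF \<phi>])
    next
      case False
      with cases have t: "t \<in> - K" by blast
      then have "\<psi>' t = 0" using K(3) K' by (simp add: \<psi>'_def)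
      show ?thesis
        by (rule has_field_derivative_transform_within_open[where S = "- K" and f = "\<lambda>_. 0"])
          (use t K(3) openK \<open>\<psi>' t = 0\<close> in auto)
    qed
    have "isCont \<psi>' t" for t
    proof (cases "t \<in> ?I")
      case True
      then have "isCont w t" "isCont w' t"
        using w_cont cont by (auto simp: continuous_on_eq_continuous_at)
      moreover have "isCont \<phi> t" "isCont (deriv \<phi>) t"
        using DERIV_isCont[OF test_function_has_deriv] \<phi> test_function_deriv by blast+
      ultimately show ?thesis unfolding \<psi>'_def by (intro continuous_intros)
    next
      case False
      with cases have t: "t \<in> - K" by blast
      have "\<And>s. s \<in> - K \<Longrightarrow> \<psi>' s = 0" using K(3) K' by (simp add: \<psi>'_def)
      with t openK have "eventually (\<lambda>s. \<psi>' s = 0) (nhds t)" by (auto simp: eventually_nhds)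
      then show ?thesis by (subst isCont_cong[where g = "\<lambda>_. 0"]) auto
    qed
    then show "continuous_on UNIV \<psi>'" by (simp add: continuous_on_eq_continuous_at)
  qed
  moreover have "(LINT t|lebesgue_on ?I. \<psi>' t *\<^sub>R g t) =
      (LINT t|lebesgue_on ?I. deriv \<phi> t *\<^sub>R (w t *\<^sub>R g t) + \<phi> t *\<^sub>R (w' t *\<^sub>R g t))"
    by (intro Bochner_Integration.integral_cong) (auto simp: \<psi>'_def scaleR_add_left mult.commute)
  moreover have "\<dots> = (LINT t|lebesgue_on ?I. deriv \<phi> t *\<^sub>R (w t *\<^sub>R g t)) +
      (LINT t|lebesgue_on ?I. \<phi> t *\<^sub>R (w' t *\<^sub>R g t))"
    by (intro Bochner_Integration.integral_add integrable_test_function wg w'g \<phi> test_function_deriv) auto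
  moreover have "(LINT t|lebesgue_on ?I. \<phi> t *\<^sub>R (w t *\<^sub>R h t + w' t *\<^sub>R g t)) =
      (LINT t|lebesgue_on ?I. \<phi> t *\<^sub>R (w t *\<^sub>R h t)) + (LINT t|lebesgue_on ?I. \<phi> t *\<^sub>R (w' t *\<^sub>R g t))"
    unfolding scaleR_add_right
    by (intro Bochner_Integration.integral_add integrable_test_function wh w'g \<phi>) auto
  ultimately show "(LINT t|lebesgue_on ?I. (deriv ^^ 1) \<phi> t *\<^sub>R (w t *\<^sub>R g t)) =
      (- 1) ^ 1 * (LINT t|lebesgue_on ?I. \<phi> t *\<^sub>R (w t *\<^sub>R h t + w' t *\<^sub>R g t))"
    by (simp add: algebra_simps)
qed

section \<open>Finite families of p-integrable functions\<close>

lemma Lp_space_iff: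
  "f \<in> Lp_space I p \<longleftrightarrow>
     f \<in> borel_measurable (lebesgue_on I) \<and> integrable (lebesgue_on I) (\<lambda>t. cmod (f t) powr p)"
  by (simp add: Lp_space_def)

lemma Lp_space_cong_AE:
  assumes "f \<in> Lp_space I p" "I \<in> sets lebesgue" "AE t in lebesgue_on I. f t = g t"
  shows "g \<in> Lp_space I p"
proof -
  have "AE t in lebesgue_on I. cmod (f t) powr p = cmod (g t) powr p"
    using assms(3) by eventually_elim simp
  with assms show ?thesis
    by (auto simp: Lp_space_iff intro: measurable_lebesgue_on_cong_AE integrable_lebesgue_on_cong_AE)
qed

definition Lp_energy :: "real set \<Rightarrow> real \<Rightarrow> (real \<Rightarrow> complex) \<Rightarrow> real" where
  "Lp_energy I p f = (LINT t|lebesgue_on I. cmod (f t) powr p)"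

lemma Lp_energy_nonneg: "Lp_energy I p f \<ge> 0"
  by (simp add: Lp_energy_def)

lemma Lp_energy_cong_AE:
  assumes "f \<in> Lp_space I p" "I \<in> sets lebesgue" "AE t in lebesgue_on I. f t = g t"
  shows "Lp_energy I p g = Lp_energy I p f"
  unfolding Lp_energy_def
proof (rule integral_cong_AE)
  show "AE t in lebesgue_on I. cmod (g t) powr p = cmod (f t) powr p"
    using assms(3) by eventually_elim simp
qed (use assms(1) Lp_space_cong_AE[OF assms] in \<open>auto simp: Lp_space_iff\<close>)

lemma powr_add_le:
  fixes x y :: real
  assumes "x \<ge> 0" "y \<ge> 0" "p \<ge> 0"
  shows "(x + y) powr p \<le> 2 powr p * (x powr p + y powr p)"
proof -
  have "(x + y) powr p \<le> (2 * max x y) powr p"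
    using assms by (intro powr_mono2) auto
  also have "\<dots> = 2 powr p * max x y powr p"
    using assms by (simp add: powr_mult)
  also have "max x y powr p \<le> x powr p + y powr p"
    by (simp add: max_def)
  finally show ?thesis by simp
qed

lemma Lp_space_add_scaled_le:
  assumes f: "f \<in> Lp_space I p" and g: "g \<in> Lp_space I p" and p: "p \<ge> 0" and B: "B \<ge> 0"
    and k: "k \<in> borel_measurable (lebesgue_on I)"
    and le: "AE t in lebesgue_on I. cmod (k t) \<le> B * (cmod (f t) + cmod (g t))"
  shows "k \<in> Lp_space I p"
    and "Lp_energy I p k \<le> (2 * B) powr p * (Lp_energy I p f + Lp_energy I p g)"
proof -
  have bound: "AE t in lebesgue_on I. cmod (k t) powr p \<le>
      (2 * B) powr p * (cmod (f t) powr p + cmod (g t) powr p)"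
    using le
  proof eventually_elim
    case (elim t)
    have "cmod (k t) powr p \<le> (B * (cmod (f t) + cmod (g t))) powr p"
      using elim p by (intro powr_mono2) auto
    also have "\<dots> = B powr p * (cmod (f t) + cmod (g t)) powr p"
      using B by (simp add: powr_mult)
    also have "\<dots> \<le> B powr p * (2 powr p * (cmod (f t) powr p + cmod (g t) powr p))"
      using p by (intro mult_left_mono powr_add_le) auto
    also have "\<dots> = (2 * B) powr p * (cmod (f t) powr p + cmod (g t) powr p)"
      using B by (simp add: powr_mult mult_ac)
    finally show ?case .
  qed
  have int: "integrable (lebesgue_on I) (\<lambda>t. (2 * B) powr p * (cmod (f t) powr p + cmod (g t) powr p))"
    using f g by (auto simp: Lp_space_iff)
  have "integrable (lebesgue_on I) (\<lambda>t. cmod (k t) powr p)"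
  proof (rule Bochner_Integration.integrable_bound[OF int])
    show "(\<lambda>t. cmod (k t) powr p) \<in> borel_measurable (lebesgue_on I)" using k by auto
    show "AE t in lebesgue_on I. norm (cmod (k t) powr p) \<le>
      norm ((2 * B) powr p * (cmod (f t) powr p + cmod (g t) powr p))"
      using bound by eventually_elim simp
  qed
  with k show "k \<in> Lp_space I p" by (simp add: Lp_space_iff)
  have "Lp_energy I p k \<le> (LINT t|lebesgue_on I. (2 * B) powr p * (cmod (f t) powr p + cmod (g t) powr p))"
    unfolding Lp_energy_def by (rule integral_mono_AE) (fact+)
  also have "\<dots> = (2 * B) powr p * (Lp_energy I p f + Lp_energy I p g)"
    using f g by (simp add: Lp_space_iff Lp_energy_def)
  finally show "Lp_energy I p k \<le> (2 * B) powr p * (Lp_energy I p f + Lp_energy I p g)" .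
qed

lemma Lp_space_cmult:
  assumes "f \<in> Lp_space I p"
  shows "(\<lambda>t. c * f t) \<in> Lp_space I p" "Lp_energy I p (\<lambda>t. c * f t) = cmod c powr p * Lp_energy I p f"
  using assms by (auto simp: Lp_space_iff Lp_energy_def norm_mult powr_mult)

lemma Lp_space_add:
  assumes "f \<in> Lp_space I p" "g \<in> Lp_space I p" "p \<ge> 0"
  shows "(\<lambda>t. f t + g t) \<in> Lp_space I p"
  by (rule Lp_space_add_scaled_le(1)[of f I p g 1])
    (use assms in \<open>auto simp: Lp_space_iff norm_triangle_ineq\<close>)

text \<open>The convexity of \<open>x powr p\<close>, applied to \<open>x / A\<close> and \<open>y / B\<close> with weights \<open>A / (A + B)\<close> and \<open>B / (A + B)\<close>. Strict
positivity of \<open>x\<close> and \<open>y\<close> is removed by a limit.\<close>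

lemma convex_powr_sum:
  fixes x y A B p :: real
  assumes p: "p \<ge> 1" and "x \<ge> 0" "y \<ge> 0" "A > 0" "B > 0"
  shows "(x + y) powr p \<le> (A + B) powr p * (A / (A + B) * (x powr p / A powr p) + B / (A + B) * (y powr p / B powr p))"
proof -
  have pos: "(u + v) powr p \<le> (A + B) powr p * (A / (A + B) * (u powr p / A powr p) + B / (A + B) * (v powr p / B powr p))"
    if "u > 0" "v > 0" for u v
  proof -
    have "(A / (A + B) * (u / A) + B / (A + B) * (v / B)) powr p \<le>
        A / (A + B) * (u / A) powr p + B / (A + B) * (v / B) powr p"
      using convex_onD[OF powr_convex[OF p], of "B / (A + B)" "u / A" "v / B"] that assms
      by (simp add: field_simps)
    also have "A / (A + B) * (u / A) + B / (A + B) * (v / B) = (u + v) / (A + B)"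
      using assms by (simp add: add_divide_distrib)
    finally show ?thesis
      using assms that by (simp add: powr_divide field_simps)
  qed
  show ?thesis
  proof (rule tendsto_le[OF trivial_limit_sequentially])
    have *: "(\<lambda>n. z + inverse (real (Suc n))) \<longlonglongrightarrow> z" for z
      using tendsto_add[OF tendsto_const LIMSEQ_inverse_real_of_nat, of z] by simp
    have **: "(\<lambda>n. (z + inverse (real (Suc n))) powr p) \<longlonglongrightarrow> z powr p" if "z \<ge> 0" for z
      by (rule tendsto_powr2[OF * tendsto_const]) (use p that in auto)
    have "(\<lambda>n. ((x + inverse (real (Suc n))) + (y + inverse (real (Suc n)))) powr p) \<longlonglongrightarrow> (x + y) powr p"
      by (rule tendsto_powr2[OF tendsto_add[OF * *] tendsto_const]) (use p assms in auto)
    then show "(\<lambda>n. ((x + inverse (real (Suc n))) + (y + inverse (real (Suc n)))) powr p) \<longlonglongrightarrow> (x + y) powr p" .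
    show "(\<lambda>n. (A + B) powr p * (A / (A + B) * ((x + inverse (real (Suc n))) powr p / A powr p) +
        B / (A + B) * ((y + inverse (real (Suc n))) powr p / B powr p))) \<longlonglongrightarrow>
      (A + B) powr p * (A / (A + B) * (x powr p / A powr p) + B / (A + B) * (y powr p / B powr p))"
      using assms by (intro tendsto_intros **) auto
    show "\<forall>\<^sub>F n in sequentially. ((x + inverse (real (Suc n))) + (y + inverse (real (Suc n)))) powr p \<le>
      (A + B) powr p * (A / (A + B) * ((x + inverse (real (Suc n))) powr p / A powr p) +
        B / (A + B) * ((y + inverse (real (Suc n))) powr p / B powr p))"
      using assms by (intro always_eventually allI pos) (auto intro!: add_nonneg_pos)
  qed
qed

definition Lp_family_norm :: "real set \<Rightarrow> real \<Rightarrow> 'i set \<Rightarrow> ('i \<Rightarrow> real \<Rightarrow> complex) \<Rightarrow> real" where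
  "Lp_family_norm I p J F = (\<Sum>i\<in>J. Lp_energy I p (F i)) powr (1 / p)"

lemma powr_le_imp_le_root:
  fixes x y p :: real
  assumes "x \<ge> 0" "y \<ge> 0" "p > 0" "x \<le> y powr p"
  shows "x powr (1 / p) \<le> y"
proof -
  have "x powr (1 / p) \<le> (y powr p) powr (1 / p)"
    using assms by (intro powr_mono2) auto
  then show ?thesis using assms by (simp add: powr_powr)
qed

lemma Lp_family_norm_nonneg: "Lp_family_norm I p J F \<ge> 0"
  by (simp add: Lp_family_norm_def)

lemma Lp_family_norm_powr:
  assumes "p > 0"
  shows "Lp_family_norm I p J F powr p = (\<Sum>i\<in>J. Lp_energy I p (F i))"
  using assms by (simp add: Lp_family_norm_def powr_powr sum_nonneg Lp_energy_nonneg)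

text \<open>The Minkowski inequality. For \<open>A\<close> and \<open>B\<close> slightly larger than the two norms, integrating and summing
\<open>convex_powr_sum\<close> gives at most \<open>(A + B)\<^sup>p\<close> times a convex combination of numbers that are at most one.
The excess \<open>e / 2\<close> keeps \<open>A\<close> and \<open>B\<close> positive when a norm vanishes.
The sum is required only almost everywhere, because weak derivatives are additive only in that sense.\<close>

lemma Lp_family_norm_triangle:
  assumes p: "p \<ge> 1" and I: "I \<in> sets lebesgue"
    and F: "\<And>i. i \<in> J \<Longrightarrow> F i \<in> Lp_space I p" and G: "\<And>i. i \<in> J \<Longrightarrow> G i \<in> Lp_space I p"
    and H: "\<And>i. i \<in> J \<Longrightarrow> AE t in lebesgue_on I. H i t = F i t + G i t"
  shows "Lp_family_norm I p J H \<le> Lp_family_norm I p J F + Lp_family_norm I p J G"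
proof (rule field_le_epsilon)
  fix e :: real assume "e > 0"
  define A where "A = Lp_family_norm I p J F + e / 2"
  define B where "B = Lp_family_norm I p J G + e / 2"
  have AB: "A > 0" "B > 0"
    using \<open>e > 0\<close> Lp_family_norm_nonneg[of I p J F] Lp_family_norm_nonneg[of I p J G]
    unfolding A_def B_def by linarith+
  have A: "(\<Sum>i\<in>J. Lp_energy I p (F i)) \<le> A powr p"
    using p \<open>e > 0\<close> Lp_family_norm_nonneg[of I p J F] unfolding A_def
    by (subst Lp_family_norm_powr[symmetric]) (auto intro!: powr_mono2)
  have B: "(\<Sum>i\<in>J. Lp_energy I p (G i)) \<le> B powr p"
    using p \<open>e > 0\<close> Lp_family_norm_nonneg[of I p J G] unfolding B_def
    by (subst Lp_family_norm_powr[symmetric]) (auto intro!: powr_mono2)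
  define a where "a = (A + B) powr p * (A / (A + B)) / A powr p"
  define b where "b = (A + B) powr p * (B / (A + B)) / B powr p"
  have ab: "a \<ge> 0" "b \<ge> 0" using AB by (auto simp: a_def b_def)
  have pointwise: "cmod (x + y) powr p \<le> a * cmod x powr p + b * cmod y powr p" for x y
  proof -
    have "cmod (x + y) powr p \<le> (cmod x + cmod y) powr p"
      using p by (intro powr_mono2 norm_triangle_ineq) auto
    also have "\<dots> \<le> a * cmod x powr p + b * cmod y powr p"
      using convex_powr_sum[OF p norm_ge_zero[of x] norm_ge_zero[of y] AB]
      by (simp add: a_def b_def algebra_simps)
    finally show ?thesis .
  qed
  have energy: "Lp_energy I p (H i) \<le> a * Lp_energy I p (F i) + b * Lp_energy I p (G i)" if i: "i \<in> J" for i
  proof -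
    have FG: "(\<lambda>t. F i t + G i t) \<in> Lp_space I p"
      using F G i p by (intro Lp_space_add) auto
    have "AE t in lebesgue_on I. F i t + G i t = H i t" using H[OF i] by auto
    then have "Lp_energy I p (H i) = Lp_energy I p (\<lambda>t. F i t + G i t)"
      by (rule Lp_energy_cong_AE[OF FG I])
    also have "\<dots> \<le> (LINT t|lebesgue_on I. a * cmod (F i t) powr p + b * cmod (G i t) powr p)"
      unfolding Lp_energy_def
      using FG F[OF i] G[OF i] by (intro integral_mono pointwise) (auto simp: Lp_space_iff)
    also have "\<dots> = a * Lp_energy I p (F i) + b * Lp_energy I p (G i)"
      using F[OF i] G[OF i] by (simp add: Lp_space_iff Lp_energy_def)
    finally show ?thesis .
  qed
  have "(\<Sum>i\<in>J. Lp_energy I p (H i)) \<le> (\<Sum>i\<in>J. a * Lp_energy I p (F i) + b * Lp_energy I p (G i))"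
    by (intro sum_mono energy)
  also have "\<dots> = a * (\<Sum>i\<in>J. Lp_energy I p (F i)) + b * (\<Sum>i\<in>J. Lp_energy I p (G i))"
    by (simp add: sum.distrib sum_distrib_left)
  also have "\<dots> \<le> a * A powr p + b * B powr p"
    using ab A B by (intro add_mono mult_left_mono)
  also have "\<dots> = (A + B) powr p * (A / (A + B) + B / (A + B))"
    using AB by (simp add: a_def b_def distrib_left)
  also have "A / (A + B) + B / (A + B) = 1"
    using AB by (simp add: add_divide_distrib[symmetric])
  finally have "Lp_family_norm I p J H \<le> A + B"
    unfolding Lp_family_norm_def using AB p
    by (intro powr_le_imp_le_root) (auto intro!: sum_nonneg Lp_energy_nonneg)
  then show "Lp_family_norm I p J H \<le> Lp_family_norm I p J F + Lp_family_norm I p J G + e"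
    by (simp add: A_def B_def)
qed

lemma Lp_family_norm_cmult:
  assumes p: "p \<ge> 1" and I: "I \<in> sets lebesgue"
    and F: "\<And>i. i \<in> J \<Longrightarrow> F i \<in> Lp_space I p"
    and H: "\<And>i. i \<in> J \<Longrightarrow> AE t in lebesgue_on I. H i t = c * F i t"
  shows "Lp_family_norm I p J H = cmod c * Lp_family_norm I p J F"
proof -
  have "Lp_energy I p (H i) = cmod c powr p * Lp_energy I p (F i)" if i: "i \<in> J" for i
  proof -
    have "AE t in lebesgue_on I. c * F i t = H i t" using H[OF i] by auto
    then have "Lp_energy I p (H i) = Lp_energy I p (\<lambda>t. c * F i t)"
      by (rule Lp_energy_cong_AE[OF Lp_space_cmult(1)[OF F[OF i]] I])
    then show ?thesis using Lp_space_cmult(2)[OF F[OF i]] by simp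
  qed
  then have "(\<Sum>i\<in>J. Lp_energy I p (H i)) = cmod c powr p * (\<Sum>i\<in>J. Lp_energy I p (F i))"
    by (simp add: sum_distrib_left)
  then show ?thesis
    using p by (simp add: Lp_family_norm_def powr_mult powr_powr sum_nonneg Lp_energy_nonneg)
qed

lemma Lp_family_norm_le:
  assumes "p \<ge> 1" "K \<ge> 0"
    and "(\<Sum>i\<in>J. Lp_energy I p (F i)) \<le> K * (\<Sum>i\<in>J. Lp_energy I p (G i))"
  shows "Lp_family_norm I p J F \<le> K powr (1 / p) * Lp_family_norm I p J G"
proof -
  have "Lp_family_norm I p J F \<le> (K * (\<Sum>i\<in>J. Lp_energy I p (G i))) powr (1 / p)"
    unfolding Lp_family_norm_def
    using assms by (intro powr_mono2) (auto intro!: sum_nonneg Lp_energy_nonneg)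
  also have "\<dots> = K powr (1 / p) * Lp_family_norm I p J G"
    unfolding Lp_family_norm_def using assms
    by (simp add: powr_mult sum_nonneg Lp_energy_nonneg)
  finally show ?thesis .
qed

lemma Lp_family_norm_eq_0D:
  assumes "p \<ge> 1" "finite J" "Lp_family_norm I p J F = 0" "i \<in> J" "F i \<in> Lp_space I p"
  shows "AE t in lebesgue_on I. F i t = 0"
proof -
  have "(\<Sum>i\<in>J. Lp_energy I p (F i)) = 0"
    using assms by (simp add: Lp_family_norm_def)
  then have "Lp_energy I p (F i) = 0"
    using assms by (simp add: sum_nonneg_eq_0_iff Lp_energy_nonneg)
  then have "AE t in lebesgue_on I. cmod (F i t) powr p = 0"
    using assms(5) unfolding Lp_energy_def
    by (subst (asm) integral_nonneg_eq_0_iff_AE) (auto simp: Lp_space_iff)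
  then show ?thesis by eventually_elim simp
qed

section \<open>Closure properties of Sobolev spaces on an interval\<close>

lemma Sobolev_space_weak_deriv:
  assumes "g \<in> Sobolev_space {l<..<r} k p" "j \<le> k"
  shows "weak_deriv {l<..<r} j g \<in> Lp_space {l<..<r} p"
    and "j > 0 \<Longrightarrow> has_weak_deriv {l<..<r} j g (weak_deriv {l<..<r} j g)"
proof -
  have *: "weak_deriv {l<..<r} j g \<in> Lp_space {l<..<r} p \<and>
      has_weak_deriv {l<..<r} j g (weak_deriv {l<..<r} j g)" if "j > 0"
  proof -
    obtain h where h: "has_weak_deriv {l<..<r} j g h" "h \<in> Lp_space {l<..<r} p"
      using assms \<open>j > 0\<close> by (force simp: Sobolev_space_def)
    have "AE t in lebesgue_on {l<..<r}. h t = weak_deriv {l<..<r} j g t"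
      using weak_deriv_AE_eq[OF h(1) that] by eventually_elim simp
    then show ?thesis
      using Lp_space_cong_AE[OF h(2)] has_weak_deriv_weak_deriv[OF h(1) that] by simp
  qed
  then show "j > 0 \<Longrightarrow> has_weak_deriv {l<..<r} j g (weak_deriv {l<..<r} j g)" by blast
  show "weak_deriv {l<..<r} j g \<in> Lp_space {l<..<r} p"
    using * assms by (cases "j = 0") (auto simp: weak_deriv_def Sobolev_space_def)
qed

lemma Sobolev_space_add:
  assumes "g \<in> Sobolev_space I k p" "g' \<in> Sobolev_space I k p" "p \<ge> 0" "I \<in> sets lebesgue"
  shows "(\<lambda>t. g t + g' t) \<in> Sobolev_space I k p"
  using assms unfolding Sobolev_space_def by (fast intro: Lp_space_add has_weak_deriv_add)

lemma Sobolev_space_cmult: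
  assumes "g \<in> Sobolev_space I k p"
  shows "(\<lambda>t. c * g t) \<in> Sobolev_space I k p"
  using assms unfolding Sobolev_space_def by (fast intro: Lp_space_cmult has_weak_deriv_cmult)

lemma Sobolev_space_zero: "(\<lambda>t. 0) \<in> Sobolev_space I k p"
  unfolding Sobolev_space_def Lp_space_iff has_weak_deriv_def locally_integrable_def
  by (auto intro!: exI[of _ "\<lambda>t. 0"])

lemma Sobolev_space_cong_AE:
  assumes "g \<in> Sobolev_space I k p" "AE t in lebesgue_on I. g t = g' t" "I \<in> sets lebesgue"
  shows "g' \<in> Sobolev_space I k p"
proof -
  have "has_weak_deriv I j g' h" if "has_weak_deriv I j g h" for j h
    by (rule has_weak_deriv_cong_AE[OF that assms(3,2)]) simp
  with assms(1) Lp_space_cong_AE[OF _ assms(3,2)] show ?thesis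
    unfolding Sobolev_space_def by blast
qed

lemma weak_deriv_add_AE:
  assumes "g \<in> Sobolev_space {l<..<r} k p" "g' \<in> Sobolev_space {l<..<r} k p" "j \<le> k"
  shows "AE t in lebesgue_on {l<..<r}. weak_deriv {l<..<r} j (\<lambda>t. g t + g' t) t =
    weak_deriv {l<..<r} j g t + weak_deriv {l<..<r} j g' t"
proof (cases "j = 0")
  case False
  then show ?thesis
    using assms by (intro weak_deriv_AE_eq has_weak_deriv_add Sobolev_space_weak_deriv(2)) auto
qed (simp add: weak_deriv_def)

lemma weak_deriv_cmult_AE:
  assumes "g \<in> Sobolev_space {l<..<r} k p" "j \<le> k"
  shows "AE t in lebesgue_on {l<..<r}. weak_deriv {l<..<r} j (\<lambda>t. c * g t) t =
    c * weak_deriv {l<..<r} j g t"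
proof (cases "j = 0")
  case False
  then show ?thesis
    using assms by (intro weak_deriv_AE_eq has_weak_deriv_cmult Sobolev_space_weak_deriv(2)) auto
qed (simp add: weak_deriv_def)

section \<open>The second tangential derivative in a chart\<close>

text \<open>What is used of the function \<open>w = 1 / \<theta>\<close> in a chart and its derivative \<open>w'\<close>. It is required only inside the
interval, because the derivative in \<open>ch_theta\<close> is two-sided and is determined
by the chart only there. One constant \<open>B\<close> bounds \<open>\<theta>\<close>, \<open>\<bar>w'\<bar>\<close> and one.\<close>

definition inverse_theta :: "chart_system \<Rightarrow> nat \<Rightarrow> (real \<Rightarrow> real) \<Rightarrow> (real \<Rightarrow> real) \<Rightarrow> real \<Rightarrow> bool" where
  "inverse_theta S r w w' B \<longleftrightarrow> 1 \<le> B \<and> continuous_on (ch_int S) w' \<and>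
     (\<forall>t\<in>ch_int S. (w has_real_derivative w' t) (at t) \<and> w t = 1 / ch_theta S r t \<and>
        0 < w t \<and> w t \<le> 1 \<and> 1 \<le> B * w t \<and> \<bar>w' t\<bar> \<le> B)"

text \<open>The derivatives \<open>\<alpha>1\<close>, \<open>\<alpha>2\<close> of the boundary function are continuous on a compact interval, hence bounded, and
\<open>w' = - \<alpha>1 \<alpha>2 / \<theta>\<^sup>3\<close>.\<close>

lemma C21_on_imp_inverse_theta:
  assumes "C21_on (- ch_a S) (ch_a S) (ch_fun S r)"
  obtains w w' B where "inverse_theta S r w w' B"
proof -
  let ?J = "{- ch_a S..ch_a S}"
  obtain \<alpha>1 \<alpha>2 L1 L2 where
      d1: "\<And>t. t \<in> ?J \<Longrightarrow> (ch_fun S r has_real_derivative \<alpha>1 t) (at t within ?J)" and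
      d2: "\<And>t. t \<in> ?J \<Longrightarrow> (\<alpha>1 has_real_derivative \<alpha>2 t) (at t within ?J)" and
      L1: "L1-lipschitz_on ?J \<alpha>1" and L2: "L2-lipschitz_on ?J \<alpha>2"
    using assms unfolding C21_on_def by metis
  have cont: "continuous_on ?J \<alpha>1" "continuous_on ?J \<alpha>2"
    using L1 L2 by (auto intro: lipschitz_on_continuous_on)
  have "\<exists>M. \<forall>t\<in>?J. \<bar>f t\<bar> \<le> M" if "continuous_on ?J f" for f :: "real \<Rightarrow> real"
    using compact_imp_bounded[OF compact_continuous_image[OF that compact_Icc]]
    by (auto simp: bounded_iff)
  then obtain M1 M2 where M: "\<forall>t\<in>?J. \<bar>\<alpha>1 t\<bar> \<le> M1" "\<forall>t\<in>?J. \<bar>\<alpha>2 t\<bar> \<le> M2"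
    using cont by meson
  have at: "at t within ?J = at t" and J: "t \<in> ?J" if "t \<in> ch_int S" for t
    using that by (auto simp: ch_int_def at_within_Icc_at)
  have deriv: "deriv (ch_fun S r) t = \<alpha>1 t" if "t \<in> ch_int S" for t
    using d1[OF J[OF that]] at[OF that] by (simp add: DERIV_imp_deriv)
  define \<theta> where "\<theta> = (\<lambda>t. sqrt (1 + (\<alpha>1 t)\<^sup>2))"
  have \<theta>: "\<theta> t \<ge> 1" for t by (simp add: \<theta>_def)
  define w where "w = (\<lambda>t. 1 / \<theta> t)"
  define w' where "w' = (\<lambda>t. - (\<alpha>1 t * \<alpha>2 t) / \<theta> t ^ 3)"
  have pos: "1 + x\<^sup>2 > 0" for x :: real
    by (smt (verit) zero_le_power2)
  have w_deriv: "(w has_real_derivative w' t) (at t)" if "t \<in> ch_int S" for t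
  proof -
    have "(\<alpha>1 has_real_derivative \<alpha>2 t) (at t)"
      using d2[OF J[OF that]] at[OF that] by simp
    then have "((\<lambda>t. 1 + (\<alpha>1 t)\<^sup>2) has_real_derivative 2 * \<alpha>1 t * \<alpha>2 t) (at t)"
      by (auto intro!: derivative_eq_intros)
    then have "(\<theta> has_real_derivative (inverse (\<theta> t) / 2) * (2 * \<alpha>1 t * \<alpha>2 t)) (at t)"
      unfolding \<theta>_def by (rule DERIV_chain2[where g = "\<lambda>t. 1 + (\<alpha>1 t)\<^sup>2", OF DERIV_real_sqrt[OF pos]])
    then have "(w has_real_derivative (0 * \<theta> t - 1 * ((inverse (\<theta> t) / 2) * (2 * \<alpha>1 t * \<alpha>2 t))) / (\<theta> t * \<theta> t)) (at t)"
      unfolding w_def using \<theta>[of t] by (intro DERIV_divide) auto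
    then show ?thesis
      unfolding w'_def using \<theta>[of t] by (simp add: field_simps power3_eq_cube)
  qed
  define B where "B = 1 + M1 + M1 * M2"
  have "\<bar>\<alpha>1 0\<bar> \<le> M1 \<and> \<bar>\<alpha>2 0\<bar> \<le> M2" if "ch_int S \<noteq> {}"
    using that M by (auto simp: ch_int_def)
  then have M0: "M1 \<ge> 0 \<and> M2 \<ge> 0" if "ch_int S \<noteq> {}" using that by fastforce
  \<comment> \<open>The maximum is for an empty interval, where nothing is known about the sign of \<open>M1\<close>.\<close>
  have "inverse_theta S r w w' (max 1 B)"
    unfolding inverse_theta_def
  proof (intro conjI ballI)
    have "continuous_on ?J w'"
      unfolding w'_def \<theta>_def using cont pos
      by (intro continuous_intros) (auto simp: less_imp_neq[symmetric])
    then show "continuous_on (ch_int S) w'"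
      by (rule continuous_on_subset) (auto simp: ch_int_def)
    fix t assume t: "t \<in> ch_int S"
    show "(w has_real_derivative w' t) (at t)" by (rule w_deriv[OF t])
    show "w t = 1 / ch_theta S r t" by (simp add: w_def \<theta>_def ch_theta_def deriv[OF t])
    show "0 < w t" "w t \<le> 1" using \<theta>[of t] by (auto simp: w_def)
    have m: "\<bar>\<alpha>1 t\<bar> \<le> M1" "\<bar>\<alpha>2 t\<bar> \<le> M2" "M1 \<ge> 0" "M2 \<ge> 0"
      using M J[OF t] M0 t by auto
    have "\<theta> t \<le> 1 + \<bar>\<alpha>1 t\<bar>"
      unfolding \<theta>_def using sqrt_sum_squares_le_sum_abs[of 1 "\<alpha>1 t"] by simp
    also have "\<dots> \<le> max 1 B" using m mult_nonneg_nonneg[OF m(3,4)] unfolding B_def by linarith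
    finally show "1 \<le> max 1 B * w t" using \<theta>[of t] by (simp add: w_def)
    have "\<bar>w' t\<bar> = \<bar>\<alpha>1 t\<bar> * \<bar>\<alpha>2 t\<bar> / \<theta> t ^ 3"
      using \<theta>[of t] by (simp add: w'_def abs_mult)
    also have "\<dots> \<le> \<bar>\<alpha>1 t\<bar> * \<bar>\<alpha>2 t\<bar> / 1"
      using \<theta>[of t] by (intro divide_left_mono) (auto intro: one_le_power)
    also have "\<dots> \<le> M1 * M2" using m by (auto intro: mult_mono)
    also have "\<dots> \<le> max 1 B" using m(3) unfolding B_def by linarith
    finally show "\<bar>w' t\<bar> \<le> max 1 B" .
  qed simp
  then show thesis by (rule that)
qed

lemma tang_deriv_AE_eq:
  assumes "inverse_theta S r w w' B"
  shows "AE t in lebesgue_on (ch_int S). w t *\<^sub>R weak_deriv (ch_int S) 1 (F r) t = tang_deriv S F r t"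
  using assms by (intro AE_I2) (auto simp: inverse_theta_def tang_deriv_def scaleR_conv_of_real)

text \<open>The product rule applied to \<open>w h\<^sub>1\<close>, the tangential derivative, whose factor \<open>h\<^sub>1\<close> has the weak derivative \<open>h\<^sub>2\<close>.\<close>

lemma tang_deriv2_eq:
  assumes u: "local_rep S u r \<in> Sobolev_space (ch_int S) 2 p" and w: "inverse_theta S r w w' B"
  defines "h1 \<equiv> weak_deriv (ch_int S) 1 (local_rep S u r)"
    and "h2 \<equiv> weak_deriv (ch_int S) 2 (local_rep S u r)"
  shows "has_weak_deriv (ch_int S) 1 (tang_deriv S (local_rep S u) r) (\<lambda>t. w t *\<^sub>R h2 t + w' t *\<^sub>R h1 t)"
    and "AE t in lebesgue_on (ch_int S). tang_deriv2 S u r t = w t *\<^sub>R (w t *\<^sub>R h2 t + w' t *\<^sub>R h1 t)"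
proof -
  obtain l r' where I: "ch_int S = {l<..<r'}" by (simp add: ch_int_def)
  have "has_weak_deriv (ch_int S) 1 (local_rep S u r) h1" "has_weak_deriv (ch_int S) 2 (local_rep S u r) h2"
    using Sobolev_space_weak_deriv(2)[OF u[unfolded I]] unfolding h1_def h2_def I by auto
  then have "has_weak_deriv (ch_int S) 1 h1 h2" by (rule has_weak_deriv_1_of_2)
  then have "has_weak_deriv (ch_int S) 1 (\<lambda>t. w t *\<^sub>R h1 t) (\<lambda>t. w t *\<^sub>R h2 t + w' t *\<^sub>R h1 t)"
    using w unfolding I by (intro has_weak_deriv_scaleR) (auto simp: inverse_theta_def I)
  then show wd: "has_weak_deriv (ch_int S) 1 (tang_deriv S (local_rep S u) r) (\<lambda>t. w t *\<^sub>R h2 t + w' t *\<^sub>R h1 t)"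
    by (rule has_weak_deriv_cong_AE[OF _ _ tang_deriv_AE_eq[OF w, of "local_rep S u", folded h1_def]])
      (auto simp: I)
  have "AE t in lebesgue_on (ch_int S). weak_deriv (ch_int S) 1 (tang_deriv S (local_rep S u) r) t =
      w t *\<^sub>R h2 t + w' t *\<^sub>R h1 t"
    using weak_deriv_AE_eq[OF wd[unfolded I]] unfolding I by simp
  with tang_deriv_AE_eq[OF w, of "tang_deriv S (local_rep S u)"]
  show "AE t in lebesgue_on (ch_int S). tang_deriv2 S u r t = w t *\<^sub>R (w t *\<^sub>R h2 t + w' t *\<^sub>R h1 t)"
    unfolding tang_deriv2_def by eventually_elim metis
qed

text \<open>The two inequalities express that \<open>\<partial>\<^sub>\<tau>\<^sup>2 u\<close> and \<open>h\<^sub>2\<close> control each other modulo \<open>h\<^sub>1\<close>. The first comes from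
the formula for \<open>\<partial>\<^sub>\<tau>\<^sup>2 u\<close>, the second from \<open>h\<^sub>2 = \<theta> (\<theta> \<partial>\<^sub>\<tau>\<^sup>2 u - w' h\<^sub>1)\<close>.\<close>

lemma tang_deriv2_Lp:
  assumes u: "local_rep S u r \<in> Sobolev_space (ch_int S) 2 p" and w: "inverse_theta S r w w' B"
    and p: "p \<ge> 1"
  defines "h1 \<equiv> weak_deriv (ch_int S) 1 (local_rep S u r)"
    and "h2 \<equiv> weak_deriv (ch_int S) 2 (local_rep S u r)"
  shows "tang_deriv2 S u r \<in> Lp_space (ch_int S) p"
    and "Lp_energy (ch_int S) p (tang_deriv2 S u r) \<le>
      (2 * B) powr p * (Lp_energy (ch_int S) p h2 + Lp_energy (ch_int S) p h1)"
    and "Lp_energy (ch_int S) p h2 \<le>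
      (2 * B\<^sup>2) powr p * (Lp_energy (ch_int S) p (tang_deriv2 S u r) + Lp_energy (ch_int S) p h1)"
proof -
  obtain l r' where I: "ch_int S = {l<..<r'}" by (simp add: ch_int_def)
  have h: "h1 \<in> Lp_space (ch_int S) p" "h2 \<in> Lp_space (ch_int S) p"
    using Sobolev_space_weak_deriv(1)[OF u[unfolded I]] unfolding h1_def h2_def I by auto
  have B: "B \<ge> 1" using w by (simp add: inverse_theta_def)
  have eq: "AE t in lebesgue_on (ch_int S). tang_deriv2 S u r t = w t *\<^sub>R (w t *\<^sub>R h2 t + w' t *\<^sub>R h1 t)"
    using tang_deriv2_eq(2)[OF u w] by (simp add: h1_def h2_def)
  have w_deriv: "(w has_real_derivative w' t) (at t)" if "t \<in> ch_int S" for t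
    using w that unfolding inverse_theta_def by blast
  have w_cont: "continuous_on (ch_int S) w" "continuous_on (ch_int S) w'"
    using continuous_at_imp_continuous_on[of "ch_int S" w] DERIV_isCont[OF w_deriv] w
    unfolding inverse_theta_def by blast+
  have w_meas: "w \<in> borel_measurable (lebesgue_on (ch_int S))" "w' \<in> borel_measurable (lebesgue_on (ch_int S))"
    by (intro continuous_imp_measurable_on_sets_lebesgue w_cont, simp add: I)+
  have "(\<lambda>t. w t *\<^sub>R (w t *\<^sub>R h2 t + w' t *\<^sub>R h1 t)) \<in> borel_measurable (lebesgue_on (ch_int S))"
    using h w_meas by (auto simp: Lp_space_iff)
  moreover have "AE t in lebesgue_on (ch_int S). w t *\<^sub>R (w t *\<^sub>R h2 t + w' t *\<^sub>R h1 t) = tang_deriv2 S u r t"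
    using eq by eventually_elim simp
  ultimately have meas: "tang_deriv2 S u r \<in> borel_measurable (lebesgue_on (ch_int S))"
    by (rule measurable_lebesgue_on_cong_AE[rotated]) (simp add: I)
  have bounds: "0 < w t" "w t \<le> 1" "1 \<le> B * w t" "\<bar>w' t\<bar> \<le> B" if "t \<in> space (lebesgue_on (ch_int S))" for t
    using that w by (auto simp: inverse_theta_def)
  have le1: "AE t in lebesgue_on (ch_int S). cmod (tang_deriv2 S u r t) \<le> B * (cmod (h2 t) + cmod (h1 t))"
    using eq AE_space
  proof eventually_elim
    case (elim t)
    note b = bounds[OF elim(2)]
    have "cmod (tang_deriv2 S u r t) = w t * cmod (w t *\<^sub>R h2 t + w' t *\<^sub>R h1 t)"
      using elim b by simp
    also have "\<dots> \<le> 1 * (\<bar>w t\<bar> * cmod (h2 t) + \<bar>w' t\<bar> * cmod (h1 t))"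
      using b by (intro mult_mono) (auto intro: order_trans[OF norm_triangle_ineq])
    also have "\<dots> \<le> 1 * (B * cmod (h2 t) + B * cmod (h1 t))"
      using b B by (intro mult_left_mono add_mono mult_right_mono) auto
    finally show ?case by (simp add: distrib_left)
  qed
  show T: "tang_deriv2 S u r \<in> Lp_space (ch_int S) p"
    and "Lp_energy (ch_int S) p (tang_deriv2 S u r) \<le>
      (2 * B) powr p * (Lp_energy (ch_int S) p h2 + Lp_energy (ch_int S) p h1)"
    using Lp_space_add_scaled_le[OF h(2,1) _ _ meas le1] p B by auto
  have le2: "AE t in lebesgue_on (ch_int S). cmod (h2 t) \<le> B\<^sup>2 * (cmod (tang_deriv2 S u r t) + cmod (h1 t))"
    using eq AE_space
  proof eventually_elim
    case (elim t)
    note b = bounds[OF elim(2)]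
    let ?T = "tang_deriv2 S u r t"
    have "cmod (h2 t) \<le> (B * w t) * cmod (h2 t)"
      using mult_right_mono[OF b(3), of "cmod (h2 t)"] by simp
    also have "\<dots> = B * cmod (w t *\<^sub>R h2 t)"
      using b by simp
    also have "w t *\<^sub>R h2 t = (w t *\<^sub>R h2 t + w' t *\<^sub>R h1 t) - w' t *\<^sub>R h1 t" by simp
    also have "B * cmod \<dots> \<le> B * (cmod (w t *\<^sub>R h2 t + w' t *\<^sub>R h1 t) + B * cmod (h1 t))"
    proof -
      have "cmod (w' t *\<^sub>R h1 t) \<le> B * cmod (h1 t)" using b(4) by (simp add: mult_right_mono)
      then show ?thesis
        using B by (intro mult_left_mono order_trans[OF norm_triangle_ineq4] add_mono) auto
    qed
    also have "\<dots> \<le> B * (B * cmod ?T + B * cmod (h1 t))"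
    proof -
      have "cmod (w t *\<^sub>R h2 t + w' t *\<^sub>R h1 t) \<le> (B * w t) * cmod (w t *\<^sub>R h2 t + w' t *\<^sub>R h1 t)"
        using mult_right_mono[OF b(3), of "cmod (w t *\<^sub>R h2 t + w' t *\<^sub>R h1 t)"] by simp
      also have "\<dots> = B * cmod ?T" using elim(1) b by simp
      finally show ?thesis using B by (intro mult_left_mono add_right_mono) auto
    qed
    finally show ?case by (simp add: power2_eq_square algebra_simps)
  qed
  show "Lp_energy (ch_int S) p h2 \<le>
      (2 * B\<^sup>2) powr p * (Lp_energy (ch_int S) p (tang_deriv2 S u r) + Lp_energy (ch_int S) p h1)"
    by (rule Lp_space_add_scaled_le(2)[OF T h(1) _ _ _ le2]) (use p h(2) in \<open>auto simp: Lp_space_iff\<close>)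
qed

section \<open>The two norms as norms of finite families\<close>

text \<open>Pairing the chart with the order of the derivative turns the nested sums in both norms into one finite sum
of integrals. The two families differ only in the entries of order two.\<close>

definition Sobolev_family :: "chart_system \<Rightarrow> (real \<times> real \<Rightarrow> complex) \<Rightarrow> nat \<times> nat \<Rightarrow> real \<Rightarrow> complex" where
  "Sobolev_family S u = (\<lambda>(r, j). weak_deriv (ch_int S) j (local_rep S u r))"

definition tang_family :: "chart_system \<Rightarrow> (real \<times> real \<Rightarrow> complex) \<Rightarrow> nat \<times> nat \<Rightarrow> real \<Rightarrow> complex" where
  "tang_family S u = (\<lambda>(r, j). if j = 2 then tang_deriv2 S u r else Sobolev_family S u (r, j))"

definition family_index :: "chart_system \<Rightarrow> (nat \<times> nat) set" where
  "family_index S = {1..ch_num S} \<times> {0..2}"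

lemma finite_family_index: "finite (family_index S)"
  by (simp add: family_index_def)

lemma sum_family_index:
  fixes f :: "nat \<times> nat \<Rightarrow> real"
  shows "(\<Sum>i\<in>family_index S. f i) = (\<Sum>r=1..ch_num S. f (r, 0) + f (r, 1) + f (r, 2))"
proof -
  have "(\<Sum>i\<in>family_index S. f i) = (\<Sum>r=1..ch_num S. \<Sum>j=0..2. f (r, j))"
    unfolding family_index_def by (simp add: sum.cartesian_product)
  also have "\<dots> = (\<Sum>r=1..ch_num S. f (r, 0) + f (r, 1) + f (r, 2))"
    by (intro sum.cong) (simp_all add: numeral_2_eq_2)
  finally show ?thesis .
qed

lemma Sobolev_norm_powr:
  assumes "p > 0"
  shows "Sobolev_norm I k p g powr p = (\<Sum>j=0..k. Lp_energy I p (weak_deriv I j g))"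
  using assms by (simp add: Sobolev_norm_def Lp_energy_def powr_powr sum_nonneg)

lemma bd_Sobolev_norm_powr:
  assumes "p > 0"
  shows "bd_Sobolev_norm S k p u powr p =
    (\<Sum>r=1..ch_num S. \<Sum>j=0..k. Lp_energy (ch_int S) p (weak_deriv (ch_int S) j (local_rep S u r)))"
  using assms by (simp add: bd_Sobolev_norm_def powr_powr sum_nonneg Lp_energy_nonneg Sobolev_norm_powr)

lemma bd_Lp_norm_powr:
  assumes "p > 0"
  shows "bd_Lp_norm S p F powr p = (\<Sum>r=1..ch_num S. Lp_energy (ch_int S) p (F r))"
  using assms by (simp add: bd_Lp_norm_def Lp_norm_def Lp_energy_def powr_powr sum_nonneg)

lemma bd_Sobolev_norm_2_eq:
  assumes "p > 0"
  shows "bd_Sobolev_norm S 2 p u = Lp_family_norm (ch_int S) p (family_index S) (Sobolev_family S u)"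
  unfolding Lp_family_norm_def sum_family_index bd_Sobolev_norm_def Sobolev_norm_powr[OF assms]
  by (simp add: Sobolev_family_def numeral_2_eq_2)

lemma tang_norm_eq:
  assumes "p > 0"
  shows "tang_norm S p u = Lp_family_norm (ch_int S) p (family_index S) (tang_family S u)"
  unfolding Lp_family_norm_def sum_family_index tang_norm_def bd_Sobolev_norm_powr[OF assms]
    bd_Lp_norm_powr[OF assms]
  by (simp add: tang_family_def Sobolev_family_def flip: sum.distrib)

lemma bd_Sobolev_iff:
  "u \<in> bd_Sobolev S k p \<longleftrightarrow> (\<forall>r\<in>{1..ch_num S}. local_rep S u r \<in> Sobolev_space (ch_int S) k p)"
  by (auto simp: bd_Sobolev_def bd_Lp_def Sobolev_space_def)

lemma local_rep_add: "local_rep S (\<lambda>x. u x + v x) r = (\<lambda>t. local_rep S u r t + local_rep S v r t)"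
  by (simp add: local_rep_def fun_eq_iff)

lemma local_rep_cmult: "local_rep S (\<lambda>x. c * u x) r = (\<lambda>t. c * local_rep S u r t)"
  by (simp add: local_rep_def fun_eq_iff)

lemma local_rep_zero: "local_rep S (\<lambda>x. 0) r = (\<lambda>t. 0)"
  by (simp add: local_rep_def fun_eq_iff)

lemma tang_deriv2_add_AE:
  assumes "local_rep S u r \<in> Sobolev_space (ch_int S) 2 p" "local_rep S v r \<in> Sobolev_space (ch_int S) 2 p"
    and p: "p \<ge> 1" and w: "inverse_theta S r w w' B"
  shows "AE t in lebesgue_on (ch_int S). tang_deriv2 S (\<lambda>x. u x + v x) r t = tang_deriv2 S u r t + tang_deriv2 S v r t"
proof -
  obtain l r' where I: "ch_int S = {l<..<r'}" by (simp add: ch_int_def)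
  have uv: "local_rep S (\<lambda>x. u x + v x) r \<in> Sobolev_space (ch_int S) 2 p"
    unfolding local_rep_add using assms by (intro Sobolev_space_add) (auto simp: I)
  note lin = weak_deriv_add_AE[OF assms(1,2)[unfolded I], folded I, folded local_rep_add]
  have "1 \<le> (2::nat)" by simp
  from lin[OF this] lin[OF order_refl]
    tang_deriv2_eq(2)[OF assms(1) w] tang_deriv2_eq(2)[OF assms(2) w] tang_deriv2_eq(2)[OF uv w]
  show ?thesis
    by eventually_elim (simp add: algebra_simps)
qed

lemma tang_deriv2_cmult_AE:
  assumes "local_rep S u r \<in> Sobolev_space (ch_int S) 2 p" and w: "inverse_theta S r w w' B"
  shows "AE t in lebesgue_on (ch_int S). tang_deriv2 S (\<lambda>x. c * u x) r t = c * tang_deriv2 S u r t"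
proof -
  obtain l r' where I: "ch_int S = {l<..<r'}" by (simp add: ch_int_def)
  have cu: "local_rep S (\<lambda>x. c * u x) r \<in> Sobolev_space (ch_int S) 2 p"
    unfolding local_rep_cmult using assms(1) by (rule Sobolev_space_cmult)
  note lin = weak_deriv_cmult_AE[OF assms(1)[unfolded I], where c = c, folded I, folded local_rep_cmult]
  have "1 \<le> (2::nat)" by simp
  from lin[OF this] lin[OF order_refl]
    tang_deriv2_eq(2)[OF assms(1) w] tang_deriv2_eq(2)[OF cu w]
  show ?thesis
    by eventually_elim (simp add: algebra_simps)
qed

text \<open>Equality almost everywhere is stated as a multiple by one, so that \<open>Lp_family_norm_cmult\<close> applies to it.\<close>

lemma tang_family_cong_AE:
  assumes "bd_ae_eq S u v" "i \<in> family_index S"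
  shows "AE t in lebesgue_on (ch_int S). tang_family S v i t = 1 * tang_family S u i t"
proof -
  obtain r j where i: "i = (r, j)" "r \<in> {1..ch_num S}" using assms(2) by (auto simp: family_index_def)
  have ae: "AE t in lebesgue_on (ch_int S). local_rep S u r t = local_rep S v r t"
    using assms(1) i(2) by (simp add: bd_ae_eq_def)
  have wd: "weak_deriv (ch_int S) k (local_rep S v r) = weak_deriv (ch_int S) k (local_rep S u r)" if "k > 0" for k
    using weak_deriv_cong_AE[OF ae _ that] by (simp add: ch_int_def)
  have unfold: "tang_deriv S F r = (\<lambda>t. weak_deriv (ch_int S) 1 (F r) t / of_real (ch_theta S r t))" for F
    by (simp add: tang_deriv_def fun_eq_iff)
  have eq: "tang_deriv S (local_rep S v) r = tang_deriv S (local_rep S u) r"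
    by (simp add: unfold wd)
  have T: "tang_deriv2 S v r = tang_deriv2 S u r"
    by (simp only: tang_deriv2_def unfold[of "tang_deriv S (local_rep S v)"]
        unfold[of "tang_deriv S (local_rep S u)"] eq)
  show ?thesis
  proof (cases "j = 0")
    case True
    with ae i show ?thesis
      by (auto simp: tang_family_def Sobolev_family_def weak_deriv_def elim!: eventually_mono)
  next
    case False
    then show ?thesis by (auto simp: i tang_family_def Sobolev_family_def T wd)
  qed
qed

section \<open>The tangential norm\<close>

context
  fixes S :: chart_system and p :: real
  assumes p: "1 \<le> p"
    and C21: "\<And>r. r \<in> {1..ch_num S} \<Longrightarrow> C21_on (- ch_a S) (ch_a S) (ch_fun S r)"
begin

lemma ex_inverse_theta: "r \<in> {1..ch_num S} \<Longrightarrow> \<exists>w w' B. inverse_theta S r w w' B"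
  using C21_on_imp_inverse_theta[OF C21] by metis

lemma tang_family_Lp:
  assumes "u \<in> bd_Sobolev S 2 p" "i \<in> family_index S"
  shows "tang_family S u i \<in> Lp_space (ch_int S) p"
proof -
  obtain r j where i: "i = (r, j)" "r \<in> {1..ch_num S}" "j \<le> 2" using assms(2) by (auto simp: family_index_def)
  obtain w w' B where w: "inverse_theta S r w w' B" using ex_inverse_theta[OF i(2)] by blast
  have u: "local_rep S u r \<in> Sobolev_space (ch_int S) 2 p" using assms(1) i(2) by (simp add: bd_Sobolev_iff)
  show ?thesis
    using tang_deriv2_Lp(1)[OF u w p] Sobolev_space_weak_deriv(1)[OF u[unfolded ch_int_def] i(3)]
    by (simp add: i(1) tang_family_def Sobolev_family_def ch_int_def)
qed

lemma tang_family_add_AE: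
  assumes "u \<in> bd_Sobolev S 2 p" "v \<in> bd_Sobolev S 2 p" "i \<in> family_index S"
  shows "AE t in lebesgue_on (ch_int S). tang_family S (\<lambda>x. u x + v x) i t = tang_family S u i t + tang_family S v i t"
proof -
  obtain r j where i: "i = (r, j)" "r \<in> {1..ch_num S}" "j \<le> 2" using assms(3) by (auto simp: family_index_def)
  obtain w w' B where w: "inverse_theta S r w w' B" using ex_inverse_theta[OF i(2)] by blast
  have uv: "local_rep S u r \<in> Sobolev_space (ch_int S) 2 p" "local_rep S v r \<in> Sobolev_space (ch_int S) 2 p"
    using assms(1,2) i(2) by (auto simp: bd_Sobolev_iff)
  show ?thesis
    using tang_deriv2_add_AE[OF uv p w] weak_deriv_add_AE[OF uv[unfolded ch_int_def] i(3), folded ch_int_def]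
    by (simp add: i(1) tang_family_def Sobolev_family_def local_rep_add)
qed

lemma tang_family_cmult_AE:
  assumes "u \<in> bd_Sobolev S 2 p" "i \<in> family_index S"
  shows "AE t in lebesgue_on (ch_int S). tang_family S (\<lambda>x. c * u x) i t = c * tang_family S u i t"
proof -
  obtain r j where i: "i = (r, j)" "r \<in> {1..ch_num S}" "j \<le> 2" using assms(2) by (auto simp: family_index_def)
  obtain w w' B where w: "inverse_theta S r w w' B" using ex_inverse_theta[OF i(2)] by blast
  have u: "local_rep S u r \<in> Sobolev_space (ch_int S) 2 p" using assms(1) i(2) by (simp add: bd_Sobolev_iff)
  show ?thesis
    using tang_deriv2_cmult_AE[OF u w] weak_deriv_cmult_AE[OF u[unfolded ch_int_def] i(3), folded ch_int_def]
    by (simp add: i(1) tang_family_def Sobolev_family_def local_rep_cmult)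
qed

lemma tang_deriv2_exists_bd_Sobolev:
  assumes "u \<in> bd_Sobolev S 2 p"
  shows "tang_deriv2_exists S u"
  unfolding tang_deriv2_exists_def
proof (intro ballI conjI)
  fix r assume r: "r \<in> {1..ch_num S}"
  obtain w w' B where w: "inverse_theta S r w w' B" using ex_inverse_theta[OF r] by blast
  have u: "local_rep S u r \<in> Sobolev_space (ch_int S) 2 p" using assms r by (simp add: bd_Sobolev_iff)
  show "\<exists>h. has_weak_deriv (ch_int S) 1 (local_rep S u r) h"
    using Sobolev_space_weak_deriv(2)[OF u[unfolded ch_int_def], of 1] by (auto simp: ch_int_def)
  show "\<exists>h. has_weak_deriv (ch_int S) 1 (tang_deriv S (local_rep S u) r) h"
    using tang_deriv2_eq(1)[OF u w] by blast
qed

lemma tang_deriv2_bd_Lp: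
  assumes "u \<in> bd_Sobolev S 2 p"
  shows "tang_deriv2 S u \<in> bd_Lp S p"
  unfolding bd_Lp_def
proof (safe)
  fix r assume "r \<in> {1..ch_num S}"
  then show "tang_deriv2 S u r \<in> Lp_space (ch_int S) p"
    using tang_family_Lp[OF assms, of "(r, 2)"] by (simp add: family_index_def tang_family_def)
qed

text \<open>Every entry of the family depends linearly on \<open>u\<close> up to null sets, so the norm axioms are inherited from
\<open>Lp_family_norm\<close>. Definiteness comes from the entries of order zero.\<close>

lemma bd_norm_on_tang_norm: "bd_norm_on S (bd_Sobolev S 2 p) (tang_norm S p)"
proof -
  let ?V = "bd_Sobolev S 2 p" and ?J = "family_index S" and ?I = "ch_int S"
  have I: "?I \<in> sets lebesgue" by (simp add: ch_int_def)
  have N: "tang_norm S p u = Lp_family_norm ?I p ?J (tang_family S u)" for u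
    using p by (intro tang_norm_eq) simp
  have zero: "(\<lambda>x. 0) \<in> ?V"
    by (simp add: bd_Sobolev_iff local_rep_zero Sobolev_space_zero)
  have add: "(\<lambda>x. u x + v x) \<in> ?V" if "u \<in> ?V" "v \<in> ?V" for u v
    using that p I by (auto simp: bd_Sobolev_iff local_rep_add intro: Sobolev_space_add)
  have cmult: "(\<lambda>x. c * u x) \<in> ?V" if "u \<in> ?V" for u c
    using that by (auto simp: bd_Sobolev_iff local_rep_cmult intro: Sobolev_space_cmult)
  have cong: "v \<in> ?V" if "u \<in> ?V" "bd_ae_eq S u v" for u v
    unfolding bd_Sobolev_iff
  proof
    fix r assume r: "r \<in> {1..ch_num S}"
    have "local_rep S u r \<in> Sobolev_space ?I 2 p" using that(1) r by (simp add: bd_Sobolev_iff)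
    moreover have "AE t in lebesgue_on ?I. local_rep S u r t = local_rep S v r t"
      using that(2) r by (simp add: bd_ae_eq_def)
    ultimately show "local_rep S v r \<in> Sobolev_space ?I 2 p" using I by (rule Sobolev_space_cong_AE)
  qed
  have N_cong: "tang_norm S p v = tang_norm S p u" if "u \<in> ?V" "bd_ae_eq S u v" for u v
    unfolding N using Lp_family_norm_cmult[OF p I tang_family_Lp[OF that(1)] tang_family_cong_AE[OF that(2)]]
    by simp
  have N_cmult: "tang_norm S p (\<lambda>x. c * u x) = cmod c * tang_norm S p u" if "u \<in> ?V" for u c
    unfolding N by (intro Lp_family_norm_cmult p I tang_family_Lp tang_family_cmult_AE that)
  have N_add: "tang_norm S p (\<lambda>x. u x + v x) \<le> tang_norm S p u + tang_norm S p v" if "u \<in> ?V" "v \<in> ?V" for u v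
    unfolding N by (intro Lp_family_norm_triangle p I tang_family_Lp tang_family_add_AE that)
  have N_zero: "tang_norm S p u = 0 \<longleftrightarrow> bd_ae_eq S u (\<lambda>x. 0)" if u: "u \<in> ?V" for u
  proof
    assume 0: "tang_norm S p u = 0"
    show "bd_ae_eq S u (\<lambda>x. 0)"
      unfolding bd_ae_eq_def local_rep_zero
    proof
      fix r assume "r \<in> {1..ch_num S}"
      then have i: "(r, 0) \<in> ?J" by (simp add: family_index_def)
      show "AE t in lebesgue_on ?I. local_rep S u r t = 0"
        using Lp_family_norm_eq_0D[OF p finite_family_index 0[unfolded N] i tang_family_Lp[OF u i]]
        by (simp add: tang_family_def Sobolev_family_def weak_deriv_def)
    qed
  next
    assume "bd_ae_eq S u (\<lambda>x. 0)"
    then have "tang_norm S p u = tang_norm S p (\<lambda>x. 0)" using N_cong[OF u] by simp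
    also have "\<dots> = tang_norm S p (\<lambda>x. 0 * u x)" by simp
    also have "\<dots> = 0" using N_cmult[OF u, of 0] by simp
    finally show "tang_norm S p u = 0" .
  qed
  have N_nonneg: "tang_norm S p u \<ge> 0" for u by (simp add: N Lp_family_norm_nonneg)
  show ?thesis
    unfolding bd_norm_on_def
    by (intro conjI ballI allI impI)
      (rule zero N_nonneg | (rule add cmult cong N_cong N_zero N_cmult N_add; assumption))+
qed

text \<open>The estimates of \<open>tang_deriv2_Lp\<close> are summed over the finitely many charts; the terms with \<open>h\<^sub>1\<close> on their
right-hand sides are absorbed by the first order part that both norms share.\<close>

lemma equivalent_tang_norm: "equivalent_on (bd_Sobolev S 2 p) (tang_norm S p) (bd_Sobolev_norm S 2 p)"
proof -
  let ?V = "bd_Sobolev S 2 p" and ?J = "family_index S" and ?I = "ch_int S"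
  let ?e = "Lp_energy ?I p"
  obtain w w' B where w: "\<And>r. r \<in> {1..ch_num S} \<Longrightarrow> inverse_theta S r (w r) (w' r) (B r)"
    using ex_inverse_theta by metis
  \<comment> \<open>A constant that serves all charts; the summand one accounts for the terms common to both norms.\<close>
  define K where "K = 1 + (\<Sum>r=1..ch_num S. (2 * B r) powr p + (2 * (B r)\<^sup>2) powr p)"
  have K: "(2 * B r) powr p + (2 * (B r)\<^sup>2) powr p \<le> K - 1" if "r \<in> {1..ch_num S}" for r
    using member_le_sum[of r "{1..ch_num S}" "\<lambda>r. (2 * B r) powr p + (2 * (B r)\<^sup>2) powr p"] that
    by (simp add: K_def)
  have K1: "K \<ge> 1" unfolding K_def by (auto intro!: sum_nonneg)
  have energies: "?e (tang_deriv2 S u r) \<le> (K - 1) * (?e (weak_deriv ?I 2 (local_rep S u r)) + ?e (weak_deriv ?I 1 (local_rep S u r)))"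
      "?e (weak_deriv ?I 2 (local_rep S u r)) \<le> (K - 1) * (?e (tang_deriv2 S u r) + ?e (weak_deriv ?I 1 (local_rep S u r)))"
    if "u \<in> ?V" and r: "r \<in> {1..ch_num S}" for u r
  proof -
    have u: "local_rep S u r \<in> Sobolev_space ?I 2 p" using that by (simp add: bd_Sobolev_iff)
    have c: "(2 * B r) powr p \<le> K - 1" "(2 * (B r)\<^sup>2) powr p \<le> K - 1"
      using K[OF r] powr_ge_zero[of "2 * B r" p] powr_ge_zero[of "2 * (B r)\<^sup>2" p] by linarith+
    show "?e (tang_deriv2 S u r) \<le> (K - 1) * (?e (weak_deriv ?I 2 (local_rep S u r)) + ?e (weak_deriv ?I 1 (local_rep S u r)))"
      by (rule order_trans[OF tang_deriv2_Lp(2)[OF u w[OF r] p]])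
        (intro mult_right_mono c add_nonneg_nonneg Lp_energy_nonneg)
    show "?e (weak_deriv ?I 2 (local_rep S u r)) \<le> (K - 1) * (?e (tang_deriv2 S u r) + ?e (weak_deriv ?I 1 (local_rep S u r)))"
      by (rule order_trans[OF tang_deriv2_Lp(3)[OF u w[OF r] p]])
        (intro mult_right_mono c add_nonneg_nonneg Lp_energy_nonneg)
  qed
  have absorb: "a + b + c \<le> K * (a + b + d)" if "c \<le> (K - 1) * (d + b)" "a \<ge> 0" "b \<ge> 0" "d \<ge> 0" for a b c d
  proof -
    have "a \<le> K * a" using K1 that(2) by (simp add: mult_le_cancel_right1)
    moreover have "d \<ge> 0" by fact
    ultimately show ?thesis using that(1) by (simp add: algebra_simps)
  qed
  have upper: "tang_norm S p u \<le> K powr (1 / p) * bd_Sobolev_norm S 2 p u" if u: "u \<in> ?V" for u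
  proof -
    have "(\<Sum>i\<in>?J. ?e (tang_family S u i)) \<le> K * (\<Sum>i\<in>?J. ?e (Sobolev_family S u i))"
      unfolding sum_family_index sum_distrib_left
    proof (rule sum_mono)
      fix r assume r: "r \<in> {1..ch_num S}"
      show "?e (tang_family S u (r, 0)) + ?e (tang_family S u (r, 1)) + ?e (tang_family S u (r, 2))
        \<le> K * (?e (Sobolev_family S u (r, 0)) + ?e (Sobolev_family S u (r, 1)) + ?e (Sobolev_family S u (r, 2)))"
        using absorb[OF energies(1)[OF u r] Lp_energy_nonneg Lp_energy_nonneg Lp_energy_nonneg]
        by (simp add: tang_family_def Sobolev_family_def)
    qed
    from Lp_family_norm_le[OF p _ this] show ?thesis
      using K1 p by (simp add: tang_norm_eq bd_Sobolev_norm_2_eq)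
  qed
  have lower: "bd_Sobolev_norm S 2 p u \<le> K powr (1 / p) * tang_norm S p u" if u: "u \<in> ?V" for u
  proof -
    have "(\<Sum>i\<in>?J. ?e (Sobolev_family S u i)) \<le> K * (\<Sum>i\<in>?J. ?e (tang_family S u i))"
      unfolding sum_family_index sum_distrib_left
    proof (rule sum_mono)
      fix r assume r: "r \<in> {1..ch_num S}"
      show "?e (Sobolev_family S u (r, 0)) + ?e (Sobolev_family S u (r, 1)) + ?e (Sobolev_family S u (r, 2))
        \<le> K * (?e (tang_family S u (r, 0)) + ?e (tang_family S u (r, 1)) + ?e (tang_family S u (r, 2)))"
        using absorb[OF energies(2)[OF u r] Lp_energy_nonneg Lp_energy_nonneg Lp_energy_nonneg]
        by (simp add: tang_family_def Sobolev_family_def)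
    qed
    from Lp_family_norm_le[OF p _ this] show ?thesis
      using K1 p by (simp add: tang_norm_eq bd_Sobolev_norm_2_eq)
  qed
  have "K powr (1 / p) > 0" using K1 by simp
  with upper lower show ?thesis
    unfolding equivalent_on_def
    by (intro exI[of _ "1 / K powr (1 / p)"] exI[of _ "K powr (1 / p)"]) (simp add: field_simps)
qed

end

theorem theorem6p1:
  fixes p :: real and \<Omega> :: "(real \<times> real) set" and S :: chart_system
  assumes "1 \<le> p"
    and "bounded_domain \<Omega>"
    and "N21_system S \<Omega>"
  shows "(\<forall>u\<in>bd_Sobolev S 2 p. tang_deriv2_exists S u \<and> tang_deriv2 S u \<in> bd_Lp S p) \<and>
         bd_norm_on S (bd_Sobolev S 2 p) (tang_norm S p) \<and>
         equivalent_on (bd_Sobolev S 2 p) (tang_norm S p) (bd_Sobolev_norm S 2 p)"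
proof -
  have C21: "C21_on (- ch_a S) (ch_a S) (ch_fun S r)" if "r \<in> {1..ch_num S}" for r
    using assms(3) that unfolding N21_system_def by blast
  show ?thesis
    using tang_deriv2_exists_bd_Sobolev[OF assms(1) C21] tang_deriv2_bd_Lp[OF assms(1) C21]
      bd_norm_on_tang_norm[OF assms(1) C21] equivalent_tang_norm[OF assms(1) C21]
    by blast
qed

end
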